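(* Let $\Sigma^2$ be an oriented surface isometrically immersed in $\mathrm{Sol}_3$. If $\Sigma^2$ has constant mean curvature (i.e. its mean curvature function $f$ is constant) and is biconservative, then $\Sigma^2$ is minimal, i.e. $f=0$.
   Context: $\mathrm{Sol}_3$ is $\mathbb{R}^3$ with coordinates $(x,y,z)$ and Riemannian metric $\langle\,,\rangle=e^{2z}dx^2+e^{-2z}dy^2+dz^2$; its Levi-Civita connection is $\bar\nabla$ and its curvature tensor is $\bar R(X,Y)Z=\bar\nabla_X\bar\nabla_YZ-\bar\nabla_Y\bar\nabla_XZ-\bar\nabla_{[X,Y]}Z$. Let $\Sigma^2$ be an oriented surface in $\mathrm{Sol}_3$ with unit normal vector field $\xi$. The shape operator $A$ is defined by $\bar\nabla_X\xi=-AX$ for $X$ tangent, and the mean curvature function is $f=\frac12\operatorname{trace}A$ (mean curvature vector field $H=f\xi$). For an isometric immersion $\phi:\Sigma^2\to N$ the tension field is $\tau(\phi)=\operatorname{trace}\nabla d\phi$ and the bitension field is $\tau_2(\phi)=\Delta\tau(\phi)-\operatorname{trace}R^N(d\phi(\cdot),\tau(\phi))d\phi(\cdot)$, with $\Delta=\operatorname{trace}\nabla^2$. The surface is called biconservative if the tangent part $\tau_2(\phi)^\top$ vanishes (equivalently, the stress-energy tensor of the bienergy is divergence free). For surfaces in $\mathrm{Sol}_3$ this is equivalent to $$A(\nabla f)+f\nabla f+f\,\operatorname{trace}(\bar R(\cdot,\xi)\cdot)^{\top}=0,$$ where the trace is taken over an orthonormal basis of the tangent plane of $\Sigma^2$ and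 $\top$ denotes the tangent part. *)

theory Defs
  imports "HOL-Analysis.Analysis"
begin

section \<open>Smooth maps between open subsets of Euclidean spaces\<close>

abbreviation partial :: "'m \<Rightarrow> (real^'m::finite \<Rightarrow> 'b::real_normed_vector) \<Rightarrow> real^'m \<Rightarrow> 'b"
  where "partial i F u \<equiv> frechet_derivative F (at u) (axis i 1)"

primrec Ck_on :: "nat \<Rightarrow> ('a::real_normed_vector) set \<Rightarrow> ('a \<Rightarrow> 'b::real_normed_vector) \<Rightarrow> bool"
  where
    "Ck_on 0 V F \<longleftrightarrow> continuous_on V F"
  | "Ck_on (Suc k) V F \<longleftrightarrow> (\<forall>x\<in>V. F differentiable (at x)) \<and>
       (\<forall>v. Ck_on k V (\<lambda>x. frechet_derivative F (at x) v))"

definition smooth_on :: "('a::real_normed_vector) set \<Rightarrow> ('a \<Rightarrow> 'b::real_normed_vector) \<Rightarrow> bool"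
  where "smooth_on V F \<longleftrightarrow> (\<forall>k. Ck_on k V F)"


section \<open>Riemannian geometry in coordinates\<close>

text \<open>A Riemannian metric on an open subset of \<open>real^'n\<close> is given by its matrix \<open>g\<close> in the
  standard coordinates; tangent vectors and vector fields are given by their components.\<close>

type_synonym 'n metric = "real^'n \<Rightarrow> real^'n^'n"
type_synonym 'n vfield = "real^'n \<Rightarrow> real^'n"

definition metric_inner :: "'n::finite metric \<Rightarrow> real^'n \<Rightarrow> real^'n \<Rightarrow> real^'n \<Rightarrow> real"
  where "metric_inner g p v w = v \<bullet> (g p *v w)"

definition christoffel :: "'n::finite metric \<Rightarrow> 'n \<Rightarrow> 'n \<Rightarrow> 'n \<Rightarrow> real^'n \<Rightarrow> real"
  where "christoffel g k i j p = (\<Sum>l\<in>UNIV. matrix_inv (g p) $ k $ l *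
      (partial i (\<lambda>q. g q $ j $ l) p + partial j (\<lambda>q. g q $ i $ l) p
        - partial l (\<lambda>q. g q $ i $ j) p)) / 2"

definition christoffel_form :: "'n::finite metric \<Rightarrow> real^'n \<Rightarrow> real^'n \<Rightarrow> real^'n \<Rightarrow> real^'n"
  where "christoffel_form g p v w =
    (\<chi> k. \<Sum>i\<in>UNIV. \<Sum>j\<in>UNIV. christoffel g k i j p * v $ i * w $ j)"

definition levi_civita :: "'n::finite metric \<Rightarrow> 'n vfield \<Rightarrow> 'n vfield \<Rightarrow> 'n vfield"
  where "levi_civita g X Y p =
    frechet_derivative Y (at p) (X p) + christoffel_form g p (X p) (Y p)"

definition lie_bracket :: "'n::finite vfield \<Rightarrow> 'n vfield \<Rightarrow> 'n vfield"
  where "lie_bracket X Y p =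
    frechet_derivative Y (at p) (X p) - frechet_derivative X (at p) (Y p)"

definition curvature :: "'n::finite metric \<Rightarrow> 'n vfield \<Rightarrow> 'n vfield \<Rightarrow> 'n vfield \<Rightarrow> 'n vfield"
  where "curvature g X Y Z p =
    levi_civita g X (levi_civita g Y Z) p - levi_civita g Y (levi_civita g X Z) p
      - levi_civita g (lie_bracket X Y) Z p"

text \<open>The curvature is tensorial, so its value on tangent vectors at \<open>p\<close> can be computed with any
  vector fields extending them; here, those with constant components.\<close>

definition curvature_at ::
    "'n::finite metric \<Rightarrow> real^'n \<Rightarrow> real^'n \<Rightarrow> real^'n \<Rightarrow> real^'n \<Rightarrow> real^'n"
  where "curvature_at g p u v w = curvature g (\<lambda>_. u) (\<lambda>_. v) (\<lambda>_. w) p"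


section \<open>Maps into a Riemannian manifold, the tension and the bitension field\<close>

text \<open>Throughout, \<open>r\<close> is (a coordinate expression of) an immersion, \<open>g\<close> the metric of the target
  and the source carries the induced metric, which makes \<open>r\<close> isometric. A vector field along
  \<open>r\<close> is a map \<open>W\<close> with \<open>W u\<close> tangent to the target at \<open>r u\<close>.\<close>

definition induced_metric :: "'n::finite metric \<Rightarrow> (real^'m::finite \<Rightarrow> real^'n) \<Rightarrow> 'm metric"
  where "induced_metric g r u = (\<chi> i j. metric_inner g (r u) (partial i r u) (partial j r u))"

definition nabla_along :: "'n::finite metric \<Rightarrow> (real^'m::finite \<Rightarrow> real^'n) \<Rightarrow>
    'm vfield \<Rightarrow> (real^'m \<Rightarrow> real^'n) \<Rightarrow> (real^'m \<Rightarrow> real^'n)"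
  where "nabla_along g r X W u = frechet_derivative W (at u) (X u)
    + christoffel_form g (r u) (frechet_derivative r (at u) (X u)) (W u)"

abbreviation coord_field :: "'m::finite \<Rightarrow> 'm vfield"
  where "coord_field i \<equiv> (\<lambda>_. axis i 1)"

text \<open>The trace, with respect to the metric \<open>h\<close>, of the bilinear form on the tangent space at
  \<open>u\<close> with components \<open>B i j\<close>.\<close>

definition metric_trace ::
    "'m::finite metric \<Rightarrow> real^'m \<Rightarrow> ('m \<Rightarrow> 'm \<Rightarrow> 'b::real_vector) \<Rightarrow> 'b"
  where "metric_trace h u B = (\<Sum>i\<in>UNIV. \<Sum>j\<in>UNIV. matrix_inv (h u) $ i $ j *\<^sub>R B i j)"

definition nabla_d :: "'n::finite metric \<Rightarrow> (real^'m::finite \<Rightarrow> real^'n) \<Rightarrow>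
    'm vfield \<Rightarrow> 'm vfield \<Rightarrow> (real^'m \<Rightarrow> real^'n)"
  where "nabla_d g r X Y u = nabla_along g r X (\<lambda>x. frechet_derivative r (at x) (Y x)) u
    - frechet_derivative r (at u) (levi_civita (induced_metric g r) X Y u)"

definition tension :: "'n::finite metric \<Rightarrow> (real^'m::finite \<Rightarrow> real^'n) \<Rightarrow> (real^'m \<Rightarrow> real^'n)"
  where "tension g r u = metric_trace (induced_metric g r) u
    (\<lambda>i j. nabla_d g r (coord_field i) (coord_field j) u)"

text \<open>\<open>(\<nabla>\<^sup>2 W)(X, Y)\<close>, with \<open>Y\<close> the inner direction of differentiation\<close>

definition nabla_square :: "'n::finite metric \<Rightarrow> (real^'m::finite \<Rightarrow> real^'n) \<Rightarrow>
    (real^'m \<Rightarrow> real^'n) \<Rightarrow> 'm vfield \<Rightarrow> 'm vfield \<Rightarrow> (real^'m \<Rightarrow> real^'n)"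
  where "nabla_square g r W X Y u = nabla_along g r X (nabla_along g r Y W) u
    - nabla_along g r (levi_civita (induced_metric g r) X Y) W u"

definition rough_laplacian :: "'n::finite metric \<Rightarrow> (real^'m::finite \<Rightarrow> real^'n) \<Rightarrow>
    (real^'m \<Rightarrow> real^'n) \<Rightarrow> (real^'m \<Rightarrow> real^'n)"
  where "rough_laplacian g r W u = metric_trace (induced_metric g r) u
    (\<lambda>i j. nabla_square g r W (coord_field i) (coord_field j) u)"

definition bitension :: "'n::finite metric \<Rightarrow> (real^'m::finite \<Rightarrow> real^'n) \<Rightarrow> (real^'m \<Rightarrow> real^'n)"
  where "bitension g r u = rough_laplacian g r (tension g r) u
    - metric_trace (induced_metric g r) u
        (\<lambda>i j. curvature_at g (r u) (partial i r u) (tension g r u) (partial j r u))"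

definition tangent_part ::
    "'n::finite metric \<Rightarrow> (real^'m::finite \<Rightarrow> real^'n) \<Rightarrow> real^'m \<Rightarrow> real^'n \<Rightarrow> real^'n"
  where "tangent_part g r u w = (THE t. t \<in> range (frechet_derivative r (at u)) \<and>
    (\<forall>v. metric_inner g (r u) (w - t) (frechet_derivative r (at u) v) = 0))"

text \<open>The shape operator with respect to the unit normal field \<open>\<xi>\<close>, as an operator on the
  coordinate tangent vectors: \<open>dr (A v) = - \<nabla>\<^sub>v \<xi>\<close>.\<close>

definition shape_operator :: "'n::finite metric \<Rightarrow> (real^'m::finite \<Rightarrow> real^'n) \<Rightarrow>
    (real^'m \<Rightarrow> real^'n) \<Rightarrow> real^'m \<Rightarrow> real^'m \<Rightarrow> real^'m"
  where "shape_operator g r \<xi> u v =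
    (THE w. frechet_derivative r (at u) w = - nabla_along g r (\<lambda>_. v) \<xi> u)"


section \<open>Immersed oriented surfaces\<close>

type_synonym 'a chart = "'a set \<times> ('a \<Rightarrow> real^2)"

definition oriented_surface :: "'a topology \<Rightarrow> 'a chart set \<Rightarrow> bool"
  where "oriented_surface M atlas \<longleftrightarrow>
    Hausdorff_space M \<and> second_countable M \<and>
    (\<Union>(U, \<psi>)\<in>atlas. U) = topspace M \<and>
    (\<forall>(U, \<psi>)\<in>atlas. openin M U \<and> open (\<psi> ` U) \<and>
       homeomorphic_map (subtopology M U) (top_of_set (\<psi> ` U)) \<psi>) \<and>
    (\<forall>(U, \<psi>)\<in>atlas. \<forall>(U', \<psi>')\<in>atlas.
       smooth_on (\<psi> ` (U \<inter> U')) (\<psi>' \<circ> inv_into U \<psi>) \<and>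
       (\<forall>u\<in>\<psi> ` (U \<inter> U'). det (matrix (frechet_derivative (\<psi>' \<circ> inv_into U \<psi>) (at u))) > 0))"

definition in_chart :: "'a chart \<Rightarrow> ('a \<Rightarrow> 'b) \<Rightarrow> (real^2 \<Rightarrow> 'b)"
  where "in_chart c F = F \<circ> inv_into (fst c) (snd c)"

definition immersion :: "'a chart set \<Rightarrow> ('a \<Rightarrow> real^'n::finite) \<Rightarrow> bool"
  where "immersion atlas \<phi> \<longleftrightarrow> (\<forall>(U, \<psi>)\<in>atlas.
    smooth_on (\<psi> ` U) (in_chart (U, \<psi>) \<phi>) \<and>
    (\<forall>u\<in>\<psi> ` U. inj (frechet_derivative (in_chart (U, \<psi>) \<phi>) (at u))))"

definition unit_normal_field ::
    "'n::finite metric \<Rightarrow> 'a chart set \<Rightarrow> ('a \<Rightarrow> real^'n) \<Rightarrow> ('a \<Rightarrow> real^'n) \<Rightarrow> bool"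
  where "unit_normal_field g atlas \<phi> \<xi> \<longleftrightarrow> (\<forall>(U, \<psi>)\<in>atlas.
    smooth_on (\<psi> ` U) (in_chart (U, \<psi>) \<xi>) \<and>
    (\<forall>p\<in>U. metric_inner g (\<phi> p) (\<xi> p) (\<xi> p) = 1 \<and>
       (\<forall>v. metric_inner g (\<phi> p) (\<xi> p)
              (frechet_derivative (in_chart (U, \<psi>) \<phi>) (at (\<psi> p)) v) = 0)))"

text \<open>\<open>f\<close> is the mean curvature function, half the trace of the shape operator. This trace does not
  depend on the chart used to compute it, so requiring it in every chart determines \<open>f\<close> on
  the surface and imposes no condition on an immersion \<open>\<phi>\<close> with unit normal field \<open>\<xi>\<close>.\<close>

definition mean_curvature_function :: "'n::finite metric \<Rightarrow> 'a chart set \<Rightarrow>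
    ('a \<Rightarrow> real^'n) \<Rightarrow> ('a \<Rightarrow> real^'n) \<Rightarrow> ('a \<Rightarrow> real) \<Rightarrow> bool"
  where "mean_curvature_function g atlas \<phi> \<xi> f \<longleftrightarrow> (\<forall>(U, \<psi>)\<in>atlas. \<forall>p\<in>U.
    f p = trace (matrix (shape_operator g (in_chart (U, \<psi>) \<phi>) (in_chart (U, \<psi>) \<xi>) (\<psi> p))) / 2)"

definition biconservative :: "'n::finite metric \<Rightarrow> 'a chart set \<Rightarrow> ('a \<Rightarrow> real^'n) \<Rightarrow> bool"
  where "biconservative g atlas \<phi> \<longleftrightarrow> (\<forall>(U, \<psi>)\<in>atlas. \<forall>u\<in>\<psi> ` U.
    tangent_part g (in_chart (U, \<psi>) \<phi>) u (bitension g (in_chart (U, \<psi>) \<phi>) u) = 0)"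


section \<open>The Riemannian manifold Sol3\<close>

definition sol_metric :: "3 metric"
  where "sol_metric p = vector [vector [exp (2 * p $ 3), 0, 0],
                                vector [0, exp (- 2 * p $ 3), 0],
                                vector [0, 0, 1]]"

end

(*
  In the orthonormal frame e^(-z) d/dx, e^z d/dy, d/dz of Sol3 the Levi-Civita connection and the
  curvature have constant coefficients, so the whole problem is expressed by the frame components
  e 1, e 2 of the coordinate tangent vectors and n of the unit normal.

  If the mean curvature is a constant c, the tension field is 2 c n. Combining the Codazzi equation
  with the derivative of trace A = 2 c, the tangent part of its bitension field is a multiple of
  c Ric(n)^T, and Ric = diag (0, 0, -2). So if c is not 0, then at each point n is vertical or
  d/dz is tangent.

  Where n is vertical the surface lies in a leaf z = const, which is minimal. If d/dz is tangent
  everywhere, write n = (- sin t, cos t, 0), let a be the 1-form dual to the tangent vector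
  (cos t, sin t, 0). The symmetry and the trace of A give dt = 2 c a - sin (2 t) dz; since
  da = cos (2 t) dz /\ a, closedness of dt yields 6 c cos (2 t) = 0. Hence t is locally constant,
  contradicting dt = 2 c a - sin (2 t) dz.
*)
theory Submission
  imports Defs
begin

section \<open>Maps of class \<open>C\<^sup>k\<close>\<close>

text \<open>Both cases are local, so a single chart around the given point suffices: if the third
  component of n is nonzero somewhere it is nonzero nearby, and otherwise it vanishes on the whole
  patch. The Ricci term survives because it occurs twice with the same sign, once in the bitension
  field and once from exchanging derivatives in the Codazzi equation. Since the tension field is 2 c
  n, the bitension field, of fourth order in the immersion, involves only second derivatives of n
  and first derivatives of the tangent vectors. The coordinate tangent vectors are not orthonormal,
  so traces contain the inverse of the induced metric. Multiplied by the Gram determinant they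
  become polynomial in the tangent vectors, and constancy of the mean curvature turns into an
  equation that can be differentiated directly. Shape operator and tangent part are definite
  descriptions; an explicit solution by the inverse Gram matrix has to precede any conclusion drawn
  from them.\<close>

lemma frechet_derivative_cong_open:
  assumes "open V" "u \<in> V" "\<And>x. x \<in> V \<Longrightarrow> F x = G x"
  shows "frechet_derivative F (at u) = frechet_derivative G (at u)"
proof -
  have "(F has_derivative D) (at u) \<longleftrightarrow> (G has_derivative D) (at u)" for D
    using assms by (auto elim: has_derivative_transform_within_open)
  then show ?thesis
    by (simp add: frechet_derivative_def)
qed

lemma differentiable_cong_open:
  assumes "open V" "u \<in> V" "\<And>x. x \<in> V \<Longrightarrow> F x = G x" "G differentiable (at u)"
  shows "F differentiable (at u)"
  using assms unfolding differentiable_def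
  by (metis has_derivative_transform_within_open)

text \<open>The closure lemmas below replace a Frechet derivative by a formula valid only on
  \<open>V\<close>; openness makes this harmless at every order.\<close>

lemma Ck_on_cong:
  assumes "open V" "\<And>x. x \<in> V \<Longrightarrow> F x = G x" "Ck_on k V G"
  shows "Ck_on k V F"
  using assms(2,3)
proof (induction k arbitrary: F G)
  case 0
  then show ?case using continuous_on_cong by fastforce
next
  case (Suc k)
  have "F differentiable (at x)" if "x \<in> V" for x
    using Suc.prems that by (auto intro: differentiable_cong_open[OF assms(1), of x F G])
  moreover have "Ck_on k V (\<lambda>x. frechet_derivative F (at x) v)" for v
    by (rule Suc.IH[of _ "\<lambda>x. frechet_derivative G (at x) v"])
      (use Suc.prems frechet_derivative_cong_open[OF assms(1), of _ F G] in auto)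
  ultimately show ?case by simp
qed

lemma Ck_on_Suc_imp: "Ck_on (Suc k) V F \<Longrightarrow> Ck_on k V F"
proof (induction k arbitrary: F)
  case 0
  then show ?case
    by (auto intro!: continuous_at_imp_continuous_on differentiable_imp_continuous_within)
next
  case (Suc k)
  then show ?case by (metis Ck_on.simps(2))
qed

lemma Ck_on_const: "Ck_on k V (\<lambda>x. c)"
  by (induction k arbitrary: c) (simp_all add: frechet_derivative_const)

lemma Ck_on_bounded_linear:
  assumes "open V" "bounded_linear L" "Ck_on k V F"
  shows "Ck_on k V (\<lambda>x. L (F x))"
  using assms(3)
proof (induction k arbitrary: F)
  case 0
  then show ?case using bounded_linear.continuous_on[OF assms(2)] by auto
next
  case (Suc k)
  have D: "((\<lambda>x. L (F x)) has_derivative (\<lambda>v. L (frechet_derivative F (at x) v))) (at x)"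
    if "x \<in> V" for x
    using Suc.prems that
    by (auto intro!: bounded_linear.has_derivative[OF assms(2)] simp: frechet_derivative_works[symmetric])
  have "Ck_on k V (\<lambda>x. frechet_derivative (\<lambda>x. L (F x)) (at x) v)" for v
    by (rule Ck_on_cong[OF assms(1) _ Suc.IH[of "\<lambda>x. frechet_derivative F (at x) v"]])
      (use Suc.prems frechet_derivative_at[OF D] in \<open>auto simp: fun_eq_iff\<close>)
  with D show ?case by (auto simp: differentiable_def)
qed

lemma Ck_on_add:
  assumes "open V" "Ck_on k V F" "Ck_on k V G"
  shows "Ck_on k V (\<lambda>x. F x + G x)"
  using assms(2,3)
proof (induction k arbitrary: F G)
  case 0
  then show ?case by (auto intro: continuous_intros)
next
  case (Suc k)
  have D: "((\<lambda>x. F x + G x) has_derivative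
      (\<lambda>v. frechet_derivative F (at x) v + frechet_derivative G (at x) v)) (at x)"
    if "x \<in> V" for x
    using Suc.prems that
    by (auto intro!: has_derivative_add simp: frechet_derivative_works[symmetric])
  have "Ck_on k V (\<lambda>x. frechet_derivative (\<lambda>x. F x + G x) (at x) v)" for v
    by (rule Ck_on_cong[OF assms(1) _ Suc.IH[of "\<lambda>x. frechet_derivative F (at x) v"
            "\<lambda>x. frechet_derivative G (at x) v"]])
      (use Suc.prems frechet_derivative_at[OF D] in \<open>auto simp: fun_eq_iff\<close>)
  with D show ?case by (auto simp: differentiable_def)
qed

lemma Ck_on_bounded_bilinear:
  assumes "open V" "bounded_bilinear B" "Ck_on k V F" "Ck_on k V G"
  shows "Ck_on k V (\<lambda>x. B (F x) (G x))"
  using assms(3,4)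
proof (induction k arbitrary: F G)
  case 0
  then show ?case using bounded_bilinear.continuous_on[OF assms(2)] by auto
next
  case (Suc k)
  have D: "((\<lambda>x. B (F x) (G x)) has_derivative
      (\<lambda>v. B (F x) (frechet_derivative G (at x) v) + B (frechet_derivative F (at x) v) (G x))) (at x)"
    if "x \<in> V" for x
    using Suc.prems that
    by (auto intro!: bounded_bilinear.FDERIV[OF assms(2)] simp: frechet_derivative_works[symmetric])
  have "Ck_on k V (\<lambda>x. B (F x) (frechet_derivative G (at x) v) + B (frechet_derivative F (at x) v) (G x))" for v
    by (intro Ck_on_add[OF assms(1)] Suc.IH Ck_on_Suc_imp[OF Suc.prems(1)]
        Ck_on_Suc_imp[OF Suc.prems(2)]) (use Suc.prems in auto)
  then have "Ck_on k V (\<lambda>x. frechet_derivative (\<lambda>x. B (F x) (G x)) (at x) v)" for v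
    by (rule Ck_on_cong[OF assms(1), rotated])
      (use frechet_derivative_at[OF D] in \<open>auto simp: fun_eq_iff\<close>)
  with D show ?case by (auto simp: differentiable_def)
qed

lemma Ck_on_exp:
  fixes F :: "'a::real_normed_vector \<Rightarrow> real"
  assumes "open V" "Ck_on k V F"
  shows "Ck_on k V (\<lambda>x. exp (F x))"
  using assms(2)
proof (induction k)
  case 0
  then show ?case by (auto intro: continuous_intros)
next
  case (Suc k)
  have D: "((\<lambda>x. exp (F x)) has_derivative
      (\<lambda>v. exp (F x) * frechet_derivative F (at x) v)) (at x)"
    if "x \<in> V" for x
    using Suc.prems that by (auto intro!: derivative_eq_intros simp: frechet_derivative_works)
  have "Ck_on k V (\<lambda>x. exp (F x) * frechet_derivative F (at x) v)" for v
    using Ck_on_Suc_imp[OF Suc.prems] Suc.prems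
    by (intro Ck_on_bounded_bilinear[OF assms(1) bounded_bilinear_mult] Suc.IH) auto
  then have "Ck_on k V (\<lambda>x. frechet_derivative (\<lambda>x. exp (F x)) (at x) v)" for v
    by (rule Ck_on_cong[OF assms(1), rotated])
      (use frechet_derivative_at[OF D] in \<open>auto simp: fun_eq_iff\<close>)
  with D show ?case by (auto simp: differentiable_def)
qed

section \<open>Symmetry of mixed second derivatives\<close>

lemma has_field_derivative_along_line:
  fixes F :: "'a::real_normed_vector \<Rightarrow> real"
  assumes "F differentiable (at (p + t *\<^sub>R a))"
  shows "((\<lambda>s. F (p + s *\<^sub>R a)) has_field_derivative frechet_derivative F (at (p + t *\<^sub>R a)) a) (at t)"
proof -
  have F: "(F has_derivative frechet_derivative F (at (p + t *\<^sub>R a))) (at (p + t *\<^sub>R a))"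
    using assms frechet_derivative_works by blast
  have "((\<lambda>s. p + s *\<^sub>R a) has_derivative (\<lambda>s. s *\<^sub>R a)) (at t)"
    by (auto intro!: derivative_eq_intros)
  from has_derivative_compose[OF this F]
  show ?thesis
    using linear_cmul[OF has_derivative_linear[OF F]]
    by (simp add: has_field_derivative_def mult_commute_abs)
qed

text \<open>The mean value theorem applies twice: along \<open>a\<close> to the difference of
  \<open>F\<close> on two parallel segments, then along \<open>b\<close> to the first derivative so
  obtained.\<close>

lemma second_difference_mean_value:
  fixes F :: "'a::real_normed_vector \<Rightarrow> real"
  assumes "Ck_on 2 V F" "0 < h"
    and V: "\<And>s t. 0 \<le> s \<Longrightarrow> s \<le> h \<Longrightarrow> 0 \<le> t \<Longrightarrow> t \<le> h \<Longrightarrow> u + s *\<^sub>R a + t *\<^sub>R b \<in> V"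
  obtains s t where "0 < s" "s < h" "0 < t" "t < h"
    "F (u + h *\<^sub>R a + h *\<^sub>R b) - F (u + h *\<^sub>R a) - F (u + h *\<^sub>R b) + F u
      = h\<^sup>2 * frechet_derivative (\<lambda>x. frechet_derivative F (at x) a) (at (u + s *\<^sub>R a + t *\<^sub>R b)) b"
proof -
  let ?F1 = "\<lambda>x. frechet_derivative F (at x) a"
  let ?\<phi> = "\<lambda>s. F (u + h *\<^sub>R b + s *\<^sub>R a) - F (u + s *\<^sub>R a)"
  have d1: "F differentiable (at x)" and d2: "?F1 differentiable (at x)" if "x \<in> V" for x
    using assms(1) that by (auto simp: numeral_2_eq_2)
  have "(?\<phi> has_field_derivative ?F1 (u + h *\<^sub>R b + s *\<^sub>R a) - ?F1 (u + s *\<^sub>R a)) (at s)"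
    if "0 \<le> s" "s \<le> h" for s
    using V[of s h] V[of s 0] that assms(2)
    by (intro derivative_intros has_field_derivative_along_line d1) (auto simp: algebra_simps)
  from MVT2[OF assms(2) this] obtain s where s: "0 < s" "s < h"
    "?\<phi> h - ?\<phi> 0 = h * (?F1 (u + h *\<^sub>R b + s *\<^sub>R a) - ?F1 (u + s *\<^sub>R a))"
    by auto
  have "((\<lambda>t. ?F1 (u + s *\<^sub>R a + t *\<^sub>R b)) has_field_derivative
      frechet_derivative ?F1 (at (u + s *\<^sub>R a + t *\<^sub>R b)) b) (at t)"
    if "0 \<le> t" "t \<le> h" for t
    using V[of s t] that s by (intro has_field_derivative_along_line d2) auto
  from MVT2[OF assms(2) this] obtain t where t: "0 < t" "t < h"
    "?F1 (u + s *\<^sub>R a + h *\<^sub>R b) - ?F1 (u + s *\<^sub>R a)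
      = h * frechet_derivative ?F1 (at (u + s *\<^sub>R a + t *\<^sub>R b)) b"
    by auto
  have "?\<phi> h - ?\<phi> 0 = h * (h * frechet_derivative ?F1 (at (u + s *\<^sub>R a + t *\<^sub>R b)) b)"
    unfolding s(3) t(3)[symmetric] by (simp add: algebra_simps)
  then show ?thesis
    using s t by (intro that[of s t]) (simp_all add: algebra_simps power2_eq_square)
qed

text \<open>The second difference over a parallelogram is symmetric in \<open>a\<close> and
  \<open>b\<close>, so the two mixed derivatives share a value at points arbitrarily near
  \<open>u\<close>; continuity at \<open>u\<close> does the rest.\<close>

lemma frechet_derivative_symmetric:
  fixes F :: "'a::real_normed_vector \<Rightarrow> real"
  assumes "open V" "Ck_on 2 V F" "u \<in> V"
  shows "frechet_derivative (\<lambda>x. frechet_derivative F (at x) a) (at u) b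
       = frechet_derivative (\<lambda>x. frechet_derivative F (at x) b) (at u) a"
proof -
  define H where "H a b x = frechet_derivative (\<lambda>x. frechet_derivative F (at x) a) (at x) b" for a b x
  have ex: "\<exists>x y. H a b x = H b a y \<and> dist x u < d \<and> dist y u < d" if "0 < d" for d
  proof -
    obtain d' where d': "d' > 0" "ball u d' \<subseteq> V"
      using assms(1,3) openE by blast
    define m where "m = min d d'"
    \<comment> \<open>Keeps the parallelogram spanned by \<open>h *\<^sub>R a\<close> and
      \<open>h *\<^sub>R b\<close> within distance \<open>m\<close> of \<open>u\<close>; the summand
      1 covers \<open>a = b = 0\<close>.\<close>
    define h where "h = m / (2 * (norm a + norm b + 1))"
    have "m > 0" using d' that by (simp add: m_def)
    have h0: "h > 0" unfolding h_def using \<open>m > 0\<close>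
      by (intro divide_pos_pos) (auto intro: add_nonneg_pos)
    have nz: "norm a + norm b + 1 > 0" by (intro add_nonneg_pos) auto
    then have "h * (2 * (norm a + norm b + 1)) = m"
      unfolding h_def by simp
    then have hm: "h * norm a + h * norm b < m" using h0 \<open>m > 0\<close>
      by (simp add: algebra_simps)
    have near: "dist (u + s *\<^sub>R a + t *\<^sub>R b) u < m" if "0 \<le> s" "s \<le> h" "0 \<le> t" "t \<le> h" for s t
    proof -
      have "dist (u + s *\<^sub>R a + t *\<^sub>R b) u \<le> s * norm a + t * norm b"
        using norm_triangle_ineq[of "s *\<^sub>R a" "t *\<^sub>R b"] that by (simp add: dist_norm add.assoc)
      also have "\<dots> \<le> h * norm a + h * norm b"
        using that by (intro add_mono mult_right_mono) auto
      finally show ?thesis using hm by simp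
    qed
    then have inV: "u + s *\<^sub>R a + t *\<^sub>R b \<in> V" if "0 \<le> s" "s \<le> h" "0 \<le> t" "t \<le> h" for s t
      using that d'(2) by (fastforce simp: m_def dist_commute)
    then have inV': "u + t *\<^sub>R b + s *\<^sub>R a \<in> V" if "0 \<le> s" "s \<le> h" "0 \<le> t" "t \<le> h" for s t
      using that by (metis add.assoc add.commute)
    obtain s t where st: "0 < s" "s < h" "0 < t" "t < h"
      "F (u + h *\<^sub>R a + h *\<^sub>R b) - F (u + h *\<^sub>R a) - F (u + h *\<^sub>R b) + F u
        = h\<^sup>2 * H a b (u + s *\<^sub>R a + t *\<^sub>R b)"
      unfolding H_def by (rule second_difference_mean_value[OF assms(2) h0, of u a b]) (rule inV)
    obtain s' t' where st': "0 < s'" "s' < h" "0 < t'" "t' < h"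
      "F (u + h *\<^sub>R b + h *\<^sub>R a) - F (u + h *\<^sub>R b) - F (u + h *\<^sub>R a) + F u
        = h\<^sup>2 * H b a (u + t' *\<^sub>R b + s' *\<^sub>R a)"
      unfolding H_def by (rule second_difference_mean_value[OF assms(2) h0, of u b a]) (rule inV')
    have "h\<^sup>2 * H a b (u + s *\<^sub>R a + t *\<^sub>R b) = h\<^sup>2 * H b a (u + s' *\<^sub>R a + t' *\<^sub>R b)"
      using st(5) st'(5) by (simp add: algebra_simps)
    then have "H a b (u + s *\<^sub>R a + t *\<^sub>R b) = H b a (u + s' *\<^sub>R a + t' *\<^sub>R b)"
      using h0 by simp
    then show ?thesis
      using near[of s t] near[of s' t'] st st' unfolding m_def
      by (intro exI[of _ "u + s *\<^sub>R a + t *\<^sub>R b"] exI[of _ "u + s' *\<^sub>R a + t' *\<^sub>R b"]) simp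
  qed
  have cont: "isCont (H a b) u" for a b
    using assms unfolding H_def
    by (auto simp: numeral_2_eq_2 continuous_on_eq_continuous_at)
  have "\<bar>H a b u - H b a u\<bar> < e" if "e > 0" for e
  proof -
    obtain d1 where d1: "d1 > 0" "\<And>x. dist x u < d1 \<Longrightarrow> dist (H a b x) (H a b u) < e/2"
      using cont[of a b] \<open>e > 0\<close> unfolding continuous_at_eps_delta by (metis half_gt_zero)
    obtain d2 where d2: "d2 > 0" "\<And>x. dist x u < d2 \<Longrightarrow> dist (H b a x) (H b a u) < e/2"
      using cont[of b a] \<open>e > 0\<close> unfolding continuous_at_eps_delta by (metis half_gt_zero)
    obtain x y where "H a b x = H b a y" "dist x u < min d1 d2" "dist y u < min d1 d2"
      using ex[of "min d1 d2"] d1 d2 by auto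
    then show ?thesis
      using d1(2)[of x] d2(2)[of y] unfolding dist_real_def min_less_iff_conj by linarith
  qed
  then have "H a b u = H b a u"
    by (metis less_irrefl right_minus_eq zero_less_abs_iff)
  then show ?thesis by (simp add: H_def)
qed

lemma frechet_derivative_vec_nth:
  assumes "W differentiable (at u)"
  shows "frechet_derivative (\<lambda>x. W x $ k) (at u) v = frechet_derivative W (at u) v $ k"
proof -
  have "((\<lambda>x. W x $ k) has_derivative (\<lambda>v. frechet_derivative W (at u) v $ k)) (at u)"
    using assms by (intro bounded_linear.has_derivative[OF bounded_linear_vec_nth]) (simp add: frechet_derivative_works)
  from fun_cong[OF frechet_derivative_at[OF this], of v] show ?thesis by simp
qed

lemma frechet_derivative_symmetric_vec:
  fixes F :: "'a::real_normed_vector \<Rightarrow> real^'k::finite"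
  assumes "open V" "Ck_on 2 V F" "u \<in> V"
  shows "frechet_derivative (\<lambda>x. frechet_derivative F (at x) a) (at u) b
       = frechet_derivative (\<lambda>x. frechet_derivative F (at x) b) (at u) a"
proof -
  have d: "F differentiable (at x)" "(\<lambda>x. frechet_derivative F (at x) a) differentiable (at x)" if "x \<in> V" for x a
    using assms(2) that by (auto simp: numeral_2_eq_2)
  have *: "frechet_derivative (\<lambda>x. frechet_derivative F (at x) a) (at u) b $ k
    = frechet_derivative (\<lambda>x. frechet_derivative (\<lambda>x. F x $ k) (at x) a) (at u) b" for a b k
    using frechet_derivative_cong_open[OF assms(1,3), of "\<lambda>x. frechet_derivative (\<lambda>x. F x $ k) (at x) a" "\<lambda>x. frechet_derivative F (at x) a $ k"]
    by (simp add: frechet_derivative_vec_nth d assms(3))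
  show ?thesis
    unfolding vec_eq_iff *
    using frechet_derivative_symmetric[OF assms(1) Ck_on_bounded_linear[OF assms(1) bounded_linear_vec_nth assms(2)] assms(3)]
    by simp
qed

text \<open>Openness of \<open>V\<close> allows a constraint such as
  \<open>n u \<bullet> n u = 1\<close> to be differentiated as an equation of functions; the
  differential relations below arise this way.\<close>

lemma has_derivative_eq_0:
  assumes "open V" "u \<in> V" "(F has_derivative D) (at u)" "\<And>x. x \<in> V \<Longrightarrow> F x = 0"
  shows "D v = 0"
proof -
  have "frechet_derivative F (at u) = frechet_derivative (\<lambda>_. 0) (at u)"
    by (rule frechet_derivative_cong_open[OF assms(1,2)]) (rule assms(4))
  then show ?thesis
    using frechet_derivative_at[OF assms(3)] by (simp add: frechet_derivative_const)
qed

section \<open>The orthonormal frame of Sol3\<close>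

lemma matrix_inv_unique:
  fixes A B :: "'a::semiring_1^'n^'n"
  assumes "A ** B = mat 1" "B ** A = mat 1"
  shows "matrix_inv A = B"
proof -
  have "A ** matrix_inv A = mat 1 \<and> matrix_inv A ** A = mat 1"
    unfolding matrix_inv_def by (rule someI[of _ B]) (use assms in auto)
  then show ?thesis
    by (metis assms(1) matrix_mul_assoc matrix_mul_lid matrix_mul_rid)
qed

text \<open>Components in the orthonormal frame \<open>exp (- z) \<partial>\<^sub>x\<close>, \<open>exp z \<partial>\<^sub>y\<close>, \<open>\<partial>\<^sub>z\<close>; the two definitions after it are the
  connection and the curvature with respect to this frame.\<close>

definition sol_coframe :: "real^3 \<Rightarrow> real^3 \<Rightarrow> real^3"
  where "sol_coframe p v = vector [exp (p $ 3) * v $ 1, exp (- p $ 3) * v $ 2, v $ 3]"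

definition sol_connection :: "real^3 \<Rightarrow> real^3 \<Rightarrow> real^3"
  where "sol_connection v w = vector [v $ 1 * w $ 3, - v $ 2 * w $ 3, v $ 2 * w $ 2 - v $ 1 * w $ 1]"

definition sol_curvature :: "real^3 \<Rightarrow> real^3 \<Rightarrow> real^3 \<Rightarrow> real^3"
  where "sol_curvature u v w =
    (let b12 = u $ 1 * v $ 2 - u $ 2 * v $ 1; b13 = u $ 1 * v $ 3 - u $ 3 * v $ 1;
         b23 = u $ 2 * v $ 3 - u $ 3 * v $ 2
     in vector [b12 * w $ 2 - b13 * w $ 3, - b12 * w $ 1 - b23 * w $ 3, b13 * w $ 1 + b23 * w $ 2])"

lemma inner_3: "v \<bullet> w = v $ 1 * w $ 1 + v $ 2 * w $ 2 + v $ 3 * w $ 3" for v w :: "real^3"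
  by (simp add: inner_vec_def sum_3)

lemma sol_coframe_nth [simp]:
  "sol_coframe p v $ 1 = exp (p $ 3) * v $ 1"
  "sol_coframe p v $ 2 = exp (- p $ 3) * v $ 2"
  "sol_coframe p v $ 3 = v $ 3"
  by (simp_all add: sol_coframe_def)

lemma sol_connection_nth [simp]:
  "sol_connection v w $ 1 = v $ 1 * w $ 3"
  "sol_connection v w $ 2 = - v $ 2 * w $ 3"
  "sol_connection v w $ 3 = v $ 2 * w $ 2 - v $ 1 * w $ 1"
  by (simp_all add: sol_connection_def)

lemma linear_sol_coframe: "linear (sol_coframe p)"
  by (rule linearI) (simp_all add: vec_eq_iff forall_3 algebra_simps)

lemma sol_coframe_eq_0_iff: "sol_coframe p v = 0 \<longleftrightarrow> v = 0"
  by (simp add: vec_eq_iff forall_3)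

lemma sol_metric_nth:
  "sol_metric p $ i $ j = (if i = j then (if i = 1 then exp (2 * p $ 3) else if i = 2 then exp (- 2 * p $ 3) else 1) else 0)"
proof -
  have "\<forall>i j. sol_metric p $ i $ j = (if i = j then (if i = 1 then exp (2 * p $ 3) else if i = 2 then exp (- 2 * p $ 3) else 1) else 0)"
    unfolding sol_metric_def forall_3 by simp
  then show ?thesis by blast
qed

lemma metric_inner_sol: "metric_inner sol_metric p v w = sol_coframe p v \<bullet> sol_coframe p w"
proof -
  have "exp (2 * p $ 3) = exp (p $ 3) * exp (p $ 3)" "exp (- (2 * p $ 3)) = exp (- p $ 3) * exp (- p $ 3)"
    by (simp_all flip: exp_add)
  then show ?thesis
    by (simp add: metric_inner_def inner_3 matrix_vector_mult_def sum_3 sol_metric_nth algebra_simps)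
qed

section \<open>Connection and curvature of Sol3, from coordinates to the frame\<close>

lemma matrix_inv_sol_metric:
  "matrix_inv (sol_metric p) = (\<chi> i j. if i = j then (if i = 1 then exp (- 2 * p $ 3) else if i = 2 then exp (2 * p $ 3) else 1) else 0)"
  by (rule matrix_inv_unique)
    (simp_all add: vec_eq_iff forall_3 matrix_matrix_mult_def sum_3 sol_metric_nth mat_def flip: exp_add)

lemma partial_sol_metric:
  "partial l (\<lambda>q. sol_metric q $ i $ j) p = (if l = 3 \<and> i = j then
     (if i = 1 then 2 * exp (2 * p $ 3) else if i = 2 then - 2 * exp (- 2 * p $ 3) else 0) else 0)"
proof -
  have "((\<lambda>q. sol_metric q $ i $ j) has_derivative (\<lambda>v. if i = j then
     (if i = 1 then 2 * exp (2 * p $ 3) * v $ 3 else if i = 2 then - 2 * exp (- 2 * p $ 3) * v $ 3 else 0) else 0)) (at p)"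
  proof -
    have 1: "((\<lambda>q. exp (2 * q $ 3)) has_derivative (\<lambda>v. 2 * exp (2 * p $ 3) * v $ 3)) (at p)"
      "((\<lambda>q. exp (- 2 * q $ 3)) has_derivative (\<lambda>v. - 2 * exp (- 2 * p $ 3) * v $ 3)) (at p)"
      for p :: "real^3"
      by (rule has_derivative_eq_rhs, (rule derivative_intros bounded_linear_imp_has_derivative bounded_linear_vec_nth)+, simp add: mult_ac)+
    show ?thesis
      unfolding sol_metric_nth using 1 by (cases "i = j"; cases "i = 1"; cases "i = 2"; simp)
  qed
  from frechet_derivative_at[OF this, symmetric] show ?thesis
    by (simp add: axis_def)
qed

lemma christoffel_form_sol:
  "christoffel_form sol_metric p v w = vector [v $ 1 * w $ 3 + v $ 3 * w $ 1,
     - (v $ 2 * w $ 3 + v $ 3 * w $ 2), exp (- 2 * p $ 3) * v $ 2 * w $ 2 - exp (2 * p $ 3) * v $ 1 * w $ 1]"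
proof -
  have "exp (2 * p $ 3) * exp (- 2 * p $ 3) = 1"
    by (simp flip: exp_add)
  then show ?thesis
    unfolding christoffel_form_def christoffel_def partial_sol_metric
    by (simp add: vec_eq_iff forall_3 sum_3 matrix_inv_sol_metric algebra_simps)
qed

lemma linear_christoffel_form: "linear (\<lambda>v. christoffel_form g p v w)"
  by (rule linearI)
    (simp_all add: christoffel_form_def vec_eq_iff sum.distrib sum_distrib_left algebra_simps)

lemma sol_coframe_axis:
  "sol_coframe p v = exp (p $ 3) *\<^sub>R (v $ 1 *\<^sub>R axis 1 1) + exp (- p $ 3) *\<^sub>R (v $ 2 *\<^sub>R axis 2 1) + v $ 3 *\<^sub>R axis 3 1"
  by (simp add: vec_eq_iff forall_3 axis_def)

lemma has_derivative_sol_coframe: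
  assumes "(r has_derivative r') (at u)" "(W has_derivative W') (at u)"
  shows "((\<lambda>x. sol_coframe (r x) (W x)) has_derivative
    (\<lambda>v. sol_coframe (r u) (W' v) + r' v $ 3 *\<^sub>R vector [exp (r u $ 3) * W u $ 1, - exp (- r u $ 3) * W u $ 2, 0])) (at u)"
proof -
  have nth: "((\<lambda>x. r x $ i) has_derivative (\<lambda>v. r' v $ i)) (at u)"
    "((\<lambda>x. W x $ i) has_derivative (\<lambda>v. W' v $ i)) (at u)" for i
    using assms by (auto intro: bounded_linear.has_derivative[OF bounded_linear_vec_nth])
  show ?thesis
    unfolding sol_coframe_axis
    by (rule has_derivative_eq_rhs, (rule derivative_intros nth)+)
      (simp add: fun_eq_iff vec_eq_iff forall_3 axis_def algebra_simps)
qed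

text \<open>Differentiating the exponential weights of the coframe accounts for exactly those
  Christoffel terms that contain the third component of the direction; the remaining ones have
  constant coefficients in the frame.\<close>

lemma sol_coframe_nabla_along:
  assumes "r differentiable (at u)" "W differentiable (at u)"
  shows "sol_coframe (r u) (nabla_along sol_metric r X W u) =
     frechet_derivative (\<lambda>x. sol_coframe (r x) (W x)) (at u) (X u)
     + sol_connection (sol_coframe (r u) (frechet_derivative r (at u) (X u))) (sol_coframe (r u) (W u))"
proof -
  have e: "exp (- (2 * r u $ 3)) = exp (- r u $ 3) * exp (- r u $ 3)" "exp (2 * r u $ 3) = exp (r u $ 3) * exp (r u $ 3)"
    by (simp_all flip: exp_add)
  have D: "frechet_derivative (\<lambda>x. sol_coframe (r x) (W x)) (at u) (X u) =
    sol_coframe (r u) (frechet_derivative W (at u) (X u)) + frechet_derivative r (at u) (X u) $ 3 *\<^sub>R vector [exp (r u $ 3) * W u $ 1, - exp (- r u $ 3) * W u $ 2, 0]"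
    by (rule fun_cong[OF frechet_derivative_at[OF
          has_derivative_sol_coframe[OF assms[unfolded frechet_derivative_works]], symmetric]])
  show ?thesis
    unfolding D by (simp add: nabla_along_def christoffel_form_sol vec_eq_iff forall_3 e algebra_simps)
qed

lemma frechet_derivative_christoffel_form_sol:
  "frechet_derivative (\<lambda>q. christoffel_form sol_metric q v w) (at p) u =
     (- 2 * u $ 3 * (exp (- 2 * p $ 3) * v $ 2 * w $ 2 + exp (2 * p $ 3) * v $ 1 * w $ 1)) *\<^sub>R axis 3 1"
proof -
  have 1: "christoffel_form sol_metric q v w = vector [v $ 1 * w $ 3 + v $ 3 * w $ 1, - (v $ 2 * w $ 3 + v $ 3 * w $ 2), 0]
     + (exp (- 2 * q $ 3) * v $ 2 * w $ 2 - exp (2 * q $ 3) * v $ 1 * w $ 1) *\<^sub>R axis 3 1" for q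
    by (simp add: christoffel_form_sol vec_eq_iff forall_3 axis_def)
  have "((\<lambda>q. christoffel_form sol_metric q v w) has_derivative
     (\<lambda>u. (- 2 * u $ 3 * (exp (- 2 * p $ 3) * v $ 2 * w $ 2 + exp (2 * p $ 3) * v $ 1 * w $ 1)) *\<^sub>R axis 3 1)) (at p)"
    unfolding 1 by (rule has_derivative_eq_rhs, (rule derivative_intros bounded_linear_imp_has_derivative bounded_linear_vec_nth)+)
      (simp add: fun_eq_iff vec_eq_iff forall_3 axis_def algebra_simps)
  from frechet_derivative_at[OF this, symmetric] show ?thesis by simp
qed

text \<open>Constant fields have zero bracket and the Christoffel form as covariant derivative, so
  only derivatives and compositions of that form enter; the coframe absorbs the
  exponentials.\<close>

lemma sol_coframe_curvature_at:
  "sol_coframe p (curvature_at sol_metric p u v w) =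
     sol_curvature (sol_coframe p u) (sol_coframe p v) (sol_coframe p w)"
proof -
  have e: "exp (- (2 * p $ 3)) = exp (- p $ 3) * exp (- p $ 3)" "exp (2 * p $ 3) = exp (p $ 3) * exp (p $ 3)"
    by (simp_all flip: exp_add)
  have e1: "exp (p $ 3) * exp (- p $ 3) = 1" "exp (p $ 3) * (exp (- p $ 3) * x) = x" for x
    by (simp_all flip: exp_add mult.assoc)
  have lc: "levi_civita sol_metric (\<lambda>_. a) (\<lambda>_. b) = (\<lambda>q. christoffel_form sol_metric q a b)" for a b
    by (simp add: levi_civita_def fun_eq_iff frechet_derivative_const)
  have br: "lie_bracket (\<lambda>_. u) (\<lambda>_. v) = (\<lambda>_. 0)"
    by (simp add: lie_bracket_def fun_eq_iff frechet_derivative_const)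
  have R: "curvature_at sol_metric p u v w =
    frechet_derivative (\<lambda>q. christoffel_form sol_metric q v w) (at p) u + christoffel_form sol_metric p u (christoffel_form sol_metric p v w)
    - (frechet_derivative (\<lambda>q. christoffel_form sol_metric q u w) (at p) v + christoffel_form sol_metric p v (christoffel_form sol_metric p u w))"
    unfolding curvature_at_def curvature_def lc br
    by (simp add: levi_civita_def linear_0[OF linear_christoffel_form])
  show ?thesis
    unfolding R frechet_derivative_christoffel_form_sol
    by (simp add: christoffel_form_sol vec_eq_iff forall_3 axis_def sol_curvature_def Let_def)
      (simp add: e e1 algebra_simps)
qed

lemma bounded_bilinear_sol_connection: "bounded_bilinear sol_connection"
  by (rule bilinear_conv_bounded_bilinear[THEN iffD1])
    (auto simp: bilinear_def intro!: linearI simp: vec_eq_iff forall_3 algebra_simps)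

lemma sol_connection_skew: "sol_connection v w \<bullet> w' + w \<bullet> sol_connection v w' = 0"
  by (simp add: inner_3 algebra_simps)

text \<open>This is the usual formula for the curvature on fields with constant frame components:
  \<open>sol_connection b a - sol_connection a b\<close> is minus their Lie bracket.\<close>

lemma sol_curvature_eq:
  "sol_connection (sol_connection b a - sol_connection a b) w
   + (sol_connection a (sol_connection b w) - sol_connection b (sol_connection a w)) = sol_curvature a b w"
  by (simp add: vec_eq_iff forall_3 sol_curvature_def Let_def algebra_simps)

text \<open>The curvature operator is diagonal on bivectors: sectional curvature 1 on the plane of
  the first two frame vectors and -1 on the two planes containing the third. Summing gives Ric =
  diag (0, 0, -2).\<close>

lemma sol_curvature_inner:
  "sol_curvature u v w \<bullet> x =
     (u $ 1 * v $ 2 - u $ 2 * v $ 1) * (x $ 1 * w $ 2 - x $ 2 * w $ 1)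
   - (u $ 1 * v $ 3 - u $ 3 * v $ 1) * (x $ 1 * w $ 3 - x $ 3 * w $ 1)
   - (u $ 2 * v $ 3 - u $ 3 * v $ 2) * (x $ 2 * w $ 3 - x $ 3 * w $ 2)"
  by (simp add: inner_3 sol_curvature_def Let_def algebra_simps)

text \<open>Pair symmetry combined with skewness in the first two arguments; it brings the curvature
  term of the Codazzi equation to the shape of that in the bitension field.\<close>

lemma sol_curvature_pair_symmetric:
  "sol_curvature u x n \<bullet> w = - (sol_curvature w n u \<bullet> x)"
  by (simp add: sol_curvature_inner algebra_simps)

text \<open>The covariant derivative in the \<open>i\<close>-th coordinate direction of a field
  along the surface, in frame components.\<close>

definition frame_nabla :: "('m \<Rightarrow> real^'m::finite \<Rightarrow> real^3) \<Rightarrow> 'm \<Rightarrow> (real^'m \<Rightarrow> real^3) \<Rightarrow> real^'m \<Rightarrow> real^3"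
  where "frame_nabla e i W u = partial i W u + sol_connection (e i u) (W u)"

section \<open>Traces over a tangent plane\<close>

definition gram :: "real^3 \<Rightarrow> real^3 \<Rightarrow> real"
  where "gram v w = (v \<bullet> v) * (w \<bullet> w) - (v \<bullet> w)\<^sup>2"

text \<open>The metric trace multiplied by the Gram determinant, hence polynomial in \<open>b\<close>.\<close>

definition adj_trace :: "(2 \<Rightarrow> real^3) \<Rightarrow> (2 \<Rightarrow> 2 \<Rightarrow> real) \<Rightarrow> real"
  where "adj_trace b B = (b 2 \<bullet> b 2) * B 1 1 - (b 1 \<bullet> b 2) * (B 1 2 + B 2 1) + (b 1 \<bullet> b 1) * B 2 2"

text \<open>The vectors \<open>b 1\<close>, \<open>b 2\<close>, \<open>n\<close> form a basis, and
  the inverse Gram matrix expands the tangent part of \<open>v\<close> in it; the trace is therefore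
  the inner product of the tangent parts of \<open>v\<close> and \<open>w\<close>.\<close>

lemma adj_trace_inner:
  fixes b :: "2 \<Rightarrow> real^3"
  assumes "n \<bullet> n = 1" "\<And>i. n \<bullet> b i = 0" "gram (b 1) (b 2) \<noteq> 0"
  shows "adj_trace b (\<lambda>i j. (v \<bullet> b i) * (w \<bullet> b j)) = gram (b 1) (b 2) * (v \<bullet> w - (v \<bullet> n) * (w \<bullet> n))"
proof -
  let ?c = "cross3 (b 1) (b 2)"
  have cc: "?c \<bullet> ?c = gram (b 1) (b 2)"
    unfolding gram_def by (simp add: cross3_def inner_3 power2_eq_square algebra_simps)
  \<comment> \<open>By the triple product expansion, whatever is orthogonal to \<open>b 1\<close>
    and \<open>b 2\<close> is parallel to their cross product.\<close>
  have par: "(?c \<bullet> ?c) *\<^sub>R x = (x \<bullet> ?c) *\<^sub>R ?c" if "x \<bullet> b 1 = 0" "x \<bullet> b 2 = 0" for x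
  proof -
    have "cross3 x ?c = (x \<bullet> b 2) *\<^sub>R b 1 - (x \<bullet> b 1) *\<^sub>R b 2"
      by (simp add: cross3_def inner_3 vec_eq_iff forall_3 algebra_simps)
    then have 0: "cross3 x ?c = 0" using that by simp
    have "(?c \<bullet> ?c) *\<^sub>R x - (x \<bullet> ?c) *\<^sub>R ?c = cross3 ?c (cross3 x ?c)"
      by (simp add: cross3_def inner_3 vec_eq_iff forall_3 algebra_simps)
    with 0 show ?thesis by simp
  qed
  have zero: "x = 0" if "x \<bullet> b 1 = 0" "x \<bullet> b 2 = 0" "x \<bullet> n = 0" for x
  proof -
    have n: "gram (b 1) (b 2) *\<^sub>R n = (n \<bullet> ?c) *\<^sub>R ?c"
      using par[of n] assms(2) cc by simp
    then have "(n \<bullet> ?c) * (x \<bullet> ?c) = gram (b 1) (b 2) * (x \<bullet> n)"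
      by (metis inner_scaleR_right)
    moreover have "n \<bullet> ?c \<noteq> 0"
      using n assms(1,3) by (metis inner_zero_left scaleR_eq_0_iff zero_neq_one)
    ultimately have "x \<bullet> ?c = 0" using that by simp
    then show "x = 0"
      using par[of x] that cc assms(3) by simp
  qed
  \<comment> \<open>The Gram determinant times the error of the expansion of \<open>v\<close>; it is
    orthogonal to all three basis vectors.\<close>
  define d where "d = gram (b 1) (b 2) *\<^sub>R v
    - ((b 2 \<bullet> b 2) * (v \<bullet> b 1) - (b 1 \<bullet> b 2) * (v \<bullet> b 2)) *\<^sub>R b 1
    - ((b 1 \<bullet> b 1) * (v \<bullet> b 2) - (b 1 \<bullet> b 2) * (v \<bullet> b 1)) *\<^sub>R b 2
    - (gram (b 1) (b 2) * (v \<bullet> n)) *\<^sub>R n"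
  have "d = 0"
    by (rule zero)
      (simp_all add: d_def inner_diff_left inner_commute[of "b _" n] inner_commute[of "b 2" "b 1"] assms
        gram_def power2_eq_square algebra_simps)
  then have "d \<bullet> w = 0" by simp
  then show ?thesis
    by (simp add: d_def adj_trace_def inner_diff_left inner_commute[of _ w] inner_commute[of "b 2" "b 1"] algebra_simps)
qed

lemma axis_nth_eq: "axis i x $ j = (if i = j then x else 0)"
  by (simp add: axis_def)

text \<open>Up to the Gram determinant the trace is \<open>- Ric(n, x)\<close>: including
  \<open>n\<close> among the directions would only add the curvature of the degenerate pair
  \<open>n\<close>, \<open>n\<close>, which is zero.\<close>

lemma adj_trace_sol_curvature:
  fixes b :: "2 \<Rightarrow> real^3"
  assumes "n \<bullet> n = 1" "\<And>i. n \<bullet> b i = 0" "gram (b 1) (b 2) \<noteq> 0"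
  shows "adj_trace b (\<lambda>i j. sol_curvature (b i) n (b j) \<bullet> x) = 2 * gram (b 1) (b 2) * (n $ 3 * x $ 3)"
proof -
  \<comment> \<open>The curvature is bilinear in the two tangent vectors, so only these sums enter;
    they form the Gram determinant times the matrix of the projection onto the tangent
    plane.\<close>
  define S where "S k l = adj_trace b (\<lambda>i j. b i $ k * b j $ l)" for k l
  have S: "S k l = gram (b 1) (b 2) * ((if k = l then 1 else 0) - n $ k * n $ l)" for k l
    using adj_trace_inner[OF assms, of "axis k 1" "axis l 1"]
    by (cases "k = l") (simp_all add: S_def inner_axis' axis_nth_eq)
  have "adj_trace b (\<lambda>i j. sol_curvature (b i) n (b j) \<bullet> x) =
      x$1 * n$2 * S 1 2 - x$1 * n$1 * S 2 2 - x$2 * n$2 * S 1 1 + x$2 * n$1 * S 2 1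
    - x$1 * n$3 * S 1 3 + x$1 * n$1 * S 3 3 + x$3 * n$3 * S 1 1 - x$3 * n$1 * S 3 1
    - x$2 * n$3 * S 2 3 + x$2 * n$2 * S 3 3 + x$3 * n$3 * S 2 2 - x$3 * n$2 * S 3 2"
    unfolding S_def adj_trace_def
    by (simp add: sol_curvature_inner algebra_simps)
  also have "\<dots> = 2 * gram (b 1) (b 2) * (n $ 3 * x $ 3)"
    unfolding S by (simp add: algebra_simps)
  finally show ?thesis .
qed

text \<open>The last hypothesis is the derivative of the one before it, where \<open>p\<close> encodes the derivatives
  of the metric, and \<open>x\<close> and \<open>y\<close> the two parts of the derivatives of \<open>q\<close>. Expanding \<open>y\<close> in the
  basis shows that the derivative of the inverse metric contributes minus twice the \<open>y\<close>-trace.\<close>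

lemma trace_derivative_identity:
  fixes E F G :: real
  assumes "E * G - F\<^sup>2 \<noteq> 0" "q21 = q12"
    and "(E * G - F\<^sup>2) * y11 = G * (q11 * p11) - F * (q11 * p12 + q12 * p11) + E * (q12 * p12)"
    and "(E * G - F\<^sup>2) * y12 = G * (q11 * p21) - F * (q11 * p22 + q12 * p21) + E * (q12 * p22)"
    and "(E * G - F\<^sup>2) * y21 = G * (q21 * p11) - F * (q21 * p12 + q22 * p11) + E * (q22 * p12)"
    and "(E * G - F\<^sup>2) * y22 = G * (q21 * p21) - F * (q21 * p22 + q22 * p21) + E * (q22 * p22)"
    and "G * q11 - F * (q12 + q21) + E * q22 = - 2 * c * (E * G - F\<^sup>2)"
    and "(p22 + p22) * q11 + G * (x11 + y11) - (p12 + p21) * (q12 + q21) - F * ((x12 + y12) + (x21 + y21))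
      + (p11 + p11) * q22 + E * (x22 + y22) + 2 * c * ((p11 + p11) * G + E * (p22 + p22) - 2 * F * (p12 + p21)) = 0"
  shows "G * x11 - F * (x12 + x21) + E * x22 = G * y11 - F * (y12 + y21) + E * y22"
proof -
  let ?D = "E * G - F\<^sup>2" and ?D' = "2 * p11 * G + E * (2 * p22) - 2 * F * (p12 + p21)"
    and ?X = "G * x11 - F * (x12 + x21) + E * x22" and ?Y = "G * y11 - F * (y12 + y21) + E * y22"
    and ?T = "2 * p22 * q11 - (p12 + p21) * (q12 + q21) + 2 * p11 * q22"
  have rearrange: "d * (k * a - t) = (k * d) * a - d * t" for d k a t :: real
    by (simp add: algebra_simps)
  have Y: "?D * ?Y = G * (?D * y11) - F * (?D * y12 + ?D * y21) + E * (?D * y22)"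
    by (simp add: algebra_simps)
  have "?X + ?Y = - 2 * c * ?D' - ?T"
    using assms(8) by (simp add: algebra_simps)
  then have "?D * (?X + ?Y) = ?D * (- 2 * c * ?D' - ?T)"
    by (simp only:)
  also have "\<dots> = (- 2 * c * ?D) * ?D' - ?D * ?T"
    by (rule rearrange)
  also have "\<dots> = (G * q11 - F * (q12 + q21) + E * q22) * ?D' - ?D * ?T"
    by (simp only: assms(7))
  also have "\<dots> = 2 * (?D * ?Y)"
    unfolding Y assms(3-6) assms(2) by (simp add: power2_eq_square algebra_simps)
  finally have "?D * (?X - ?Y) = 0"
    by (simp add: algebra_simps)
  with assms(1) show ?thesis by simp
qed

lemma adj_trace_add: "adj_trace b (\<lambda>i j. B i j + C i j) = adj_trace b B + adj_trace b C"
  by (simp add: adj_trace_def algebra_simps)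

lemma adj_trace_diff: "adj_trace b (\<lambda>i j. B i j - C i j) = adj_trace b B - adj_trace b C"
  by (simp add: adj_trace_def algebra_simps)

lemma adj_trace_minus: "adj_trace b (\<lambda>i j. - B i j) = - adj_trace b B"
  by (simp add: adj_trace_def algebra_simps)

lemma adj_trace_transpose: "adj_trace b (\<lambda>i j. B j i) = adj_trace b B"
  by (simp add: adj_trace_def)

section \<open>Surfaces in frame components\<close>

text \<open>Everything is expressed by frame components: \<open>e i\<close> are those of the coordinate tangent vectors and
  \<open>n\<close> those of the unit normal. The metric enters only through the standard inner product.\<close>

locale sol_surface =
  fixes V :: "(real^2) set" and e :: "2 \<Rightarrow> real^2 \<Rightarrow> real^3" and n :: "real^2 \<Rightarrow> real^3"
  assumes open_V: "open V"
    and e_differentiable: "u \<in> V \<Longrightarrow> e i differentiable (at u)"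
    and n_C2: "Ck_on 2 V n"
    and torsion_free: "u \<in> V \<Longrightarrow> frame_nabla e i (e j) u = frame_nabla e j (e i) u"
    and n_unit: "u \<in> V \<Longrightarrow> n u \<bullet> n u = 1"
    and n_normal: "u \<in> V \<Longrightarrow> n u \<bullet> e i u = 0"
    and gram_nonzero: "u \<in> V \<Longrightarrow> gram (e 1 u) (e 2 u) \<noteq> 0"
begin

abbreviation "D \<equiv> frame_nabla e"

lemma n_differentiable: "u \<in> V \<Longrightarrow> n differentiable (at u)"
  and dn_differentiable: "u \<in> V \<Longrightarrow> partial i n differentiable (at u)"
  using n_C2 by (auto simp: numeral_2_eq_2)

lemma has_derivative_connection:
  assumes "u \<in> V" "W differentiable (at u)"
  shows "((\<lambda>x. sol_connection (e i x) (W x)) has_derivative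
    (\<lambda>v. sol_connection (e i u) (frechet_derivative W (at u) v) + sol_connection (frechet_derivative (e i) (at u) v) (W u))) (at u)"
  by (intro bounded_bilinear.FDERIV[OF bounded_bilinear_sol_connection] frechet_derivative_works[THEN iffD1] assms e_differentiable)

lemma Dn_differentiable: "u \<in> V \<Longrightarrow> D i n differentiable (at u)"
  unfolding frame_nabla_def
  by (rule differentiable_add[OF dn_differentiable differentiableI[OF has_derivative_connection]])
    (auto intro: n_differentiable)

text \<open>Metric compatibility: the connection terms cancel by skewness.\<close>

lemma partial_inner:
  assumes "W differentiable (at u)" "W' differentiable (at u)"
  shows "partial i (\<lambda>x. W x \<bullet> W' x) u = D i W u \<bullet> W' u + W u \<bullet> D i W' u"
proof -
  have "((\<lambda>x. W x \<bullet> W' x) has_derivative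
     (\<lambda>v. W u \<bullet> frechet_derivative W' (at u) v + frechet_derivative W (at u) v \<bullet> W' u)) (at u)"
    by (intro has_derivative_inner frechet_derivative_works[THEN iffD1] assms)
  from fun_cong[OF frechet_derivative_at[OF this], of "axis i 1"] show ?thesis
    using sol_connection_skew[of "e i u" "W u" "W' u"]
    by (simp add: frame_nabla_def inner_add_left inner_add_right)
qed

lemma has_derivative_inner_works:
  assumes "W differentiable (at u)" "W' differentiable (at u)"
  shows "((\<lambda>x. W x \<bullet> W' x) has_derivative frechet_derivative (\<lambda>x. W x \<bullet> W' x) (at u)) (at u)"
  using assms by (intro frechet_derivative_works[THEN iffD1]) auto

lemma D_inner_zero:
  assumes "u \<in> V" "W differentiable (at u)" "W' differentiable (at u)" "\<And>x. x \<in> V \<Longrightarrow> W x \<bullet> W' x = 0"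
  shows "D i W u \<bullet> W' u = - (W u \<bullet> D i W' u)"
  using has_derivative_eq_0[OF open_V assms(1) has_derivative_inner_works[OF assms(2,3)] assms(4), of "axis i 1"]
    partial_inner[OF assms(2,3), of i]
  by simp

section \<open>The second fundamental form and the Codazzi equation\<close>

lemma Dn_normal:
  assumes "u \<in> V" shows "D i n u \<bullet> n u = 0"
proof -
  have "((\<lambda>x. n x \<bullet> n x - 1) has_derivative frechet_derivative (\<lambda>x. n x \<bullet> n x) (at u)) (at u)"
    by (rule has_derivative_eq_rhs, (rule derivative_intros has_derivative_inner_works n_differentiable assms)+) simp
  from has_derivative_eq_0[OF open_V assms this, of "axis i 1"] show ?thesis
    using partial_inner[OF n_differentiable n_differentiable, OF assms assms, of i] n_unit
    by (simp add: inner_commute)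
qed

text \<open>Both sides are minus the second fundamental form, as the shape operator is minus the
  derivative of the normal; hence the sign in the trace hypotheses
  \<open>- 2 * c * gram (e 1 u) (e 2 u)\<close>.\<close>

lemma Dn_inner_e: "u \<in> V \<Longrightarrow> D i n u \<bullet> e j u = - (n u \<bullet> D i (e j) u)"
  by (intro D_inner_zero n_differentiable e_differentiable n_normal)

lemma Dn_symmetric: "u \<in> V \<Longrightarrow> D i n u \<bullet> e j u = D j n u \<bullet> e i u"
  by (simp add: Dn_inner_e torsion_free)

text \<open>Coordinate directions commute, so no bracket term appears. The second derivatives of
  \<open>n\<close> cancel by symmetry, and torsion-freeness turns the remaining derivatives of
  \<open>e\<close> into algebraic terms that make up the curvature.\<close>

lemma commutator:
  assumes "u \<in> V"
  shows "D i (D j n) u - D j (D i n) u = sol_curvature (e i u) (e j u) (n u)"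
proof -
  have DD: "D i (D j n) u = frechet_derivative (partial j n) (at u) (axis i 1)
      + (sol_connection (e j u) (partial i n u) + sol_connection (partial i (e j) u) (n u))
      + sol_connection (e i u) (partial j n u + sol_connection (e j u) (n u))" for i j
  proof -
    have "(D j n has_derivative (\<lambda>v. frechet_derivative (partial j n) (at u) v
      + (sol_connection (e j u) (frechet_derivative n (at u) v) + sol_connection (frechet_derivative (e j) (at u) v) (n u)))) (at u)"
      unfolding frame_nabla_def
      by (intro has_derivative_add frechet_derivative_works[THEN iffD1] has_derivative_connection assms dn_differentiable n_differentiable)
    from fun_cong[OF frechet_derivative_at[OF this], of "axis i 1"] show ?thesis
      by (simp add: frame_nabla_def)
  qed
  have t: "partial i (e j) u - partial j (e i) u = sol_connection (e j u) (e i u) - sol_connection (e i u) (e j u)"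
    using torsion_free[OF assms, of i j] by (simp add: frame_nabla_def algebra_simps)
  interpret sc: bounded_bilinear sol_connection by (rule bounded_bilinear_sol_connection)
  have "D i (D j n) u - D j (D i n) u = sol_connection (partial i (e j) u - partial j (e i) u) (n u)
    + (sol_connection (e i u) (sol_connection (e j u) (n u)) - sol_connection (e j u) (sol_connection (e i u) (n u)))"
    using frechet_derivative_symmetric_vec[OF open_V n_C2 assms, of "axis i 1" "axis j 1"]
    unfolding DD by (simp add: sc.add_left sc.add_right sc.diff_left sc.diff_right algebra_simps)
  then show ?thesis
    unfolding t sol_curvature_eq .
qed

text \<open>Differentiate the symmetry of the second fundamental form, then exchange derivatives.
  This moves the free index \<open>m\<close> outermost, where tracing over \<open>i\<close> and
  \<open>j\<close> meets the derivative of the constant mean curvature.\<close>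

lemma codazzi:
  assumes "u \<in> V"
  shows "D i (D j n) u \<bullet> e m u = D m (D i n) u \<bullet> e j u + sol_curvature (e i u) (e m u) (n u) \<bullet> e j u
    + D m n u \<bullet> D i (e j) u - D j n u \<bullet> D i (e m) u"
proof -
  have "partial i (\<lambda>x. D j n x \<bullet> e m x) u = partial i (\<lambda>x. D m n x \<bullet> e j x) u"
    by (rule fun_cong[OF frechet_derivative_cong_open[OF open_V assms]]) (rule Dn_symmetric)
  then have "D i (D j n) u \<bullet> e m u + D j n u \<bullet> D i (e m) u = D i (D m n) u \<bullet> e j u + D m n u \<bullet> D i (e j) u"
    by (simp only: partial_inner[OF Dn_differentiable e_differentiable, OF assms assms])
  moreover have "D i (D m n) u \<bullet> e j u = D m (D i n) u \<bullet> e j u + sol_curvature (e i u) (e m u) (n u) \<bullet> e j u"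
    by (simp flip: commutator[OF assms] add: inner_diff_left)
  ultimately show ?thesis by linarith
qed

lemma differentiated_trace:
  assumes trace: "\<And>u. u \<in> V \<Longrightarrow> adj_trace (\<lambda>i. e i u) (\<lambda>i j. D i n u \<bullet> e j u) = - 2 * c * gram (e 1 u) (e 2 u)"
    and u: "u \<in> V"
  shows "adj_trace (\<lambda>i. e i u) (\<lambda>i j. D m (D i n) u \<bullet> e j u) = adj_trace (\<lambda>i. e i u) (\<lambda>i j. D i n u \<bullet> D m (e j) u)"
proof -
  let ?g = "\<lambda>i j x. e i x \<bullet> e j x" and ?q = "\<lambda>i j x. D i n x \<bullet> e j x"
  let ?dg = "\<lambda>i j. frechet_derivative (?g i j) (at u)" and ?dq = "\<lambda>i j. frechet_derivative (?q i j) (at u)"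
  have g: "(?g i j has_derivative ?dg i j) (at u)" for i j
    by (intro has_derivative_inner_works e_differentiable u)
  have q: "(?q i j has_derivative ?dq i j) (at u)" for i j
    by (intro has_derivative_inner_works e_differentiable Dn_differentiable u)
  have dg: "?dg i j (axis m 1) = D m (e i) u \<bullet> e j u + D m (e j) u \<bullet> e i u" for i j
    by (simp add: partial_inner e_differentiable u inner_commute[of "e i u"])
  have dq: "?dq i j (axis m 1) = D m (D i n) u \<bullet> e j u + D i n u \<bullet> D m (e j) u" for i j
    by (simp add: partial_inner e_differentiable Dn_differentiable u)
  have "((\<lambda>x. ?g 2 2 x * ?q 1 1 x - ?g 1 2 x * (?q 1 2 x + ?q 2 1 x) + ?g 1 1 x * ?q 2 2 x
      + 2 * c * (?g 1 1 x * ?g 2 2 x - ?g 1 2 x * ?g 1 2 x)) has_derivative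
    (\<lambda>v. ?dg 2 2 v * ?q 1 1 u + ?g 2 2 u * ?dq 1 1 v - ?dg 1 2 v * (?q 1 2 u + ?q 2 1 u) - ?g 1 2 u * (?dq 1 2 v + ?dq 2 1 v)
      + ?dg 1 1 v * ?q 2 2 u + ?g 1 1 u * ?dq 2 2 v
      + 2 * c * (?dg 1 1 v * ?g 2 2 u + ?g 1 1 u * ?dg 2 2 v - 2 * ?g 1 2 u * ?dg 1 2 v))) (at u)"
    by (rule has_derivative_eq_rhs, (rule has_derivative_add has_derivative_diff has_derivative_mult has_derivative_const g q)+)
      (simp add: fun_eq_iff algebra_simps)
  moreover have "?g 2 2 x * ?q 1 1 x - ?g 1 2 x * (?q 1 2 x + ?q 2 1 x) + ?g 1 1 x * ?q 2 2 x
      + 2 * c * (?g 1 1 x * ?g 2 2 x - ?g 1 2 x * ?g 1 2 x) = 0" if "x \<in> V" for x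
    using trace[OF that] by (simp add: adj_trace_def gram_def power2_eq_square)
  ultimately have N: "?dg 2 2 (axis m 1) * ?q 1 1 u + ?g 2 2 u * ?dq 1 1 (axis m 1) - ?dg 1 2 (axis m 1) * (?q 1 2 u + ?q 2 1 u)
      - ?g 1 2 u * (?dq 1 2 (axis m 1) + ?dq 2 1 (axis m 1)) + ?dg 1 1 (axis m 1) * ?q 2 2 u + ?g 1 1 u * ?dq 2 2 (axis m 1)
      + 2 * c * (?dg 1 1 (axis m 1) * ?g 2 2 u + ?g 1 1 u * ?dg 2 2 (axis m 1) - 2 * ?g 1 2 u * ?dg 1 2 (axis m 1)) = 0"
    by (rule has_derivative_eq_0[OF open_V u])
  \<comment> \<open>\<open>D i n u\<close> is tangent, so its inner product with any
    \<open>w\<close> is recovered from those with the tangent basis.\<close>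
  have ex: "gram (e 1 u) (e 2 u) * (D i n u \<bullet> w) = adj_trace (\<lambda>i. e i u) (\<lambda>k l. (D i n u \<bullet> e k u) * (w \<bullet> e l u))" for i w
    using adj_trace_inner[of "n u" "\<lambda>i. e i u" "D i n u" w] u
    by (simp add: n_unit n_normal gram_nonzero Dn_normal)
  let ?p = "\<lambda>i j. D m (e i) u \<bullet> e j u" and ?x = "\<lambda>i j. D m (D i n) u \<bullet> e j u"
    and ?y = "\<lambda>i j. D i n u \<bullet> D m (e j) u"
  let ?\<Delta> = "?g 1 1 u * ?g 2 2 u - (?g 1 2 u)\<^sup>2"
  have y: "?\<Delta> * ?y i j = ?g 2 2 u * (?q i 1 u * ?p j 1) - ?g 1 2 u * (?q i 1 u * ?p j 2 + ?q i 2 u * ?p j 1)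
      + ?g 1 1 u * (?q i 2 u * ?p j 2)" for i j
    using ex[of i "D m (e j) u"] by (simp only: adj_trace_def gram_def)
  have \<Delta>: "?\<Delta> \<noteq> 0"
    using gram_nonzero[OF u] by (simp add: gram_def)
  have t: "?g 2 2 u * ?q 1 1 u - ?g 1 2 u * (?q 1 2 u + ?q 2 1 u) + ?g 1 1 u * ?q 2 2 u = - 2 * c * ?\<Delta>"
    using trace[OF u] by (simp only: adj_trace_def gram_def)
  show ?thesis
    unfolding adj_trace_def
    by (rule trace_derivative_identity[OF \<Delta> Dn_symmetric[OF u] y y y y t N[unfolded dg dq]])
qed

text \<open>\<open>bicons\<close> is the component of the bitension field along \<open>e m\<close>,
  up to the factor \<open>2 * c\<close> and the Gram determinant. After the Codazzi equation its
  derivative part has trace zero because the mean curvature is constant, while the two curvature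
  terms add up.\<close>

lemma normal_tangent_vertical:
  assumes trace: "\<And>u. u \<in> V \<Longrightarrow> adj_trace (\<lambda>i. e i u) (\<lambda>i j. D i n u \<bullet> e j u) = - 2 * c * gram (e 1 u) (e 2 u)"
    and u: "u \<in> V"
    and bicons: "adj_trace (\<lambda>i. e i u) (\<lambda>i j. D i (D j n) u \<bullet> e m u - D m n u \<bullet> D i (e j) u
      - sol_curvature (e i u) (n u) (e j u) \<bullet> e m u) = 0"
  shows "n u $ 3 * e m u $ 3 = 0"
proof -
  let ?A = "adj_trace (\<lambda>i. e i u)"
  have 1: "D i (D j n) u \<bullet> e m u - D m n u \<bullet> D i (e j) u - sol_curvature (e i u) (n u) (e j u) \<bullet> e m u
    = (D m (D i n) u \<bullet> e j u - D j n u \<bullet> D m (e i) u)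
      - (sol_curvature (e j u) (n u) (e i u) \<bullet> e m u + sol_curvature (e i u) (n u) (e j u) \<bullet> e m u)" for i j
    using codazzi[OF u, of i j m] sol_curvature_pair_symmetric[of "e i u" "e m u" "n u" "e j u"]
      torsion_free[OF u, of i m]
    by simp
  have "?A (\<lambda>i j. D j n u \<bullet> D m (e i) u) = ?A (\<lambda>i j. D m (D i n) u \<bullet> e j u)"
    using adj_trace_transpose[of "\<lambda>i. e i u" "\<lambda>i j. D i n u \<bullet> D m (e j) u"] differentiated_trace[OF trace u, of m]
    by simp
  moreover have "?A (\<lambda>i j. sol_curvature (e i u) (n u) (e j u) \<bullet> e m u) = 2 * gram (e 1 u) (e 2 u) * (n u $ 3 * e m u $ 3)"
    by (rule adj_trace_sol_curvature) (use u in \<open>simp_all add: n_unit n_normal gram_nonzero\<close>)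
  moreover have "?A (\<lambda>i j. sol_curvature (e j u) (n u) (e i u) \<bullet> e m u) = ?A (\<lambda>i j. sol_curvature (e i u) (n u) (e j u) \<bullet> e m u)"
    by (rule adj_trace_transpose)
  ultimately have "gram (e 1 u) (e 2 u) * (n u $ 3 * e m u $ 3) = 0"
    using bicons unfolding 1 adj_trace_diff adj_trace_add by auto
  then show ?thesis using gram_nonzero[OF u] by simp
qed

section \<open>The two cases for the unit normal\<close>

lemma adj_trace_components:
  assumes "u \<in> V"
  shows "adj_trace (\<lambda>i. e i u) (\<lambda>i j. e i u $ k * e j u $ l) = gram (e 1 u) (e 2 u) * ((if k = l then 1 else 0) - n u $ k * n u $ l)"
  using adj_trace_inner[of "n u" "\<lambda>i. e i u" "axis k 1" "axis l 1"] assms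
  by (cases "k = l") (simp_all add: n_unit n_normal gram_nonzero inner_axis' axis_nth_eq)

lemma has_derivative_n_nth: "u \<in> V \<Longrightarrow> ((\<lambda>x. n x $ k) has_derivative (\<lambda>v. frechet_derivative n (at u) v $ k)) (at u)"
  by (intro bounded_linear.has_derivative[OF bounded_linear_vec_nth] frechet_derivative_works[THEN iffD1] n_differentiable)

lemma horizontal_imp_minimal:
  assumes trace: "\<And>u. u \<in> V \<Longrightarrow> adj_trace (\<lambda>i. e i u) (\<lambda>i j. D i n u \<bullet> e j u) = - 2 * c * gram (e 1 u) (e 2 u)"
    and vert: "\<And>u m. u \<in> V \<Longrightarrow> n u $ 3 * e m u $ 3 = 0"
    and u: "u \<in> V" "n u $ 3 \<noteq> 0"
  shows "c = 0"
proof -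
  \<comment> \<open>Here \<open>vert\<close> makes the tangent plane horizontal; differentiating
    \<open>n\<close> at \<open>u\<close> needs this on a neighbourhood.\<close>
  define W where "W = {x \<in> V. n x $ 3 \<noteq> 0}"
  have "continuous_on V (\<lambda>x. n x $ 3)"
    by (rule continuous_at_imp_continuous_on) (blast intro: has_derivative_continuous has_derivative_n_nth)
  then have "open (V \<inter> (\<lambda>x. n x $ 3) -` (- {0}))"
    by (rule continuous_open_preimage) (auto intro: open_V)
  then have W: "open W" "u \<in> W"
    using u by (auto simp: W_def Int_def vimage_def)
  have n: "n x $ 1 = 0" "n x $ 2 = 0" "n x $ 3 * n x $ 3 - 1 = 0" if "x \<in> W" for x
  proof -
    have x: "x \<in> V" "n x $ 3 \<noteq> 0" "e i x $ 3 = 0" for i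
      using that vert[of x i] by (auto simp: W_def)
    \<comment> \<open>No tangent vector has a third component, so the third row of the projection
      matrix vanishes.\<close>
    then have "(if 3 = k then 1 else 0) - n x $ 3 * n x $ k = 0" for k
      using adj_trace_components[OF x(1), of 3 k] gram_nonzero[OF x(1)] by (simp add: adj_trace_def)
    from this[of 1] this[of 2] this[of 3] x(2) show "n x $ 1 = 0" "n x $ 2 = 0" "n x $ 3 * n x $ 3 - 1 = 0"
      by simp_all
  qed
  have "partial i n u $ 1 = 0" "partial i n u $ 2 = 0" for i
    using n has_derivative_eq_0[OF W has_derivative_n_nth[OF u(1)]] by blast+
  moreover have "partial i n u $ 3 = 0" for i
  proof -
    have "((\<lambda>x. n x $ 3 * n x $ 3 - 1) has_derivative (\<lambda>v. 2 * (n u $ 3 * frechet_derivative n (at u) v $ 3))) (at u)"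
      by (rule has_derivative_eq_rhs, (rule derivative_intros has_derivative_n_nth u)+) simp
    from has_derivative_eq_0[OF W this n(3), of "axis i 1"] show ?thesis
      using u(2) by simp
  qed
  \<comment> \<open>Only the connection term is left: the two horizontal frame vectors are principal
    directions with opposite curvatures.\<close>
  ultimately have Dn: "D i n u \<bullet> e j u = n u $ 3 * (e i u $ 1 * e j u $ 1 - e i u $ 2 * e j u $ 2)" for i j
    using n[OF W(2)] by (simp add: frame_nabla_def inner_3 algebra_simps)
  have "adj_trace (\<lambda>i. e i u) (\<lambda>i j. D i n u \<bullet> e j u)
    = n u $ 3 * (adj_trace (\<lambda>i. e i u) (\<lambda>i j. e i u $ 1 * e j u $ 1) - adj_trace (\<lambda>i. e i u) (\<lambda>i j. e i u $ 2 * e j u $ 2))"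
    unfolding adj_trace_def Dn by (simp add: algebra_simps)
  also have "\<dots> = 0"
    unfolding adj_trace_components[OF u(1)] using n[OF W(2)] by simp
  finally show ?thesis
    using trace[OF u(1)] gram_nonzero[OF u(1)] by simp
qed

lemma vertical_imp_minimal:
  assumes trace: "\<And>u. u \<in> V \<Longrightarrow> adj_trace (\<lambda>i. e i u) (\<lambda>i j. D i n u \<bullet> e j u) = - 2 * c * gram (e 1 u) (e 2 u)"
    and n3: "\<And>u. u \<in> V \<Longrightarrow> n u $ 3 = 0"
    and "V \<noteq> {}"
  shows "c = 0"
proof -
  txt \<open>\<open>\<theta>\<close> is the differential of the angle \<open>t\<close> with \<open>n = (- sin t, cos t, 0)\<close>; thus
    \<open>2 * n $ 1 * n $ 2 = - sin (2 * t)\<close> and \<open>(n $ 2)\<^sup>2 - (n $ 1)\<^sup>2 = cos (2 * t)\<close>.\<close>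
  define a where "a i u = e i u $ 1 * n u $ 2 - e i u $ 2 * n u $ 1" for i u
  define z where "z i u = e i u $ 3" for i u
  define \<theta> where "\<theta> i u = n u $ 1 * partial i n u $ 2 - n u $ 2 * partial i n u $ 1" for i u
  define \<delta> where "\<delta> u = a 1 u * z 2 u - a 2 u * z 1 u" for u
  have unit: "n u $ 1 * n u $ 1 + n u $ 2 * n u $ 2 = 1" if "u \<in> V" for u
    using n_unit[OF that] n3[OF that] by (simp add: inner_3)
  have ea: "e i u $ 1 = a i u * n u $ 2" "e i u $ 2 = - a i u * n u $ 1" if "u \<in> V" for i u
    using n_normal[OF that, of i] n3[OF that] unit[OF that] unfolding a_def inner_3 by algebra+
  have dn3: "partial i n u $ 3 = 0" if "u \<in> V" for i u
    by (rule has_derivative_eq_0[OF open_V that has_derivative_n_nth[OF that] n3])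
  have dn: "partial i n u $ 1 = - \<theta> i u * n u $ 2" "partial i n u $ 2 = \<theta> i u * n u $ 1" if "u \<in> V" for i u
  proof -
    have "((\<lambda>x. n x $ 1 * n x $ 1 + n x $ 2 * n x $ 2 - 1) has_derivative
      (\<lambda>v. 2 * (n u $ 1 * frechet_derivative n (at u) v $ 1 + n u $ 2 * frechet_derivative n (at u) v $ 2))) (at u)"
      by (rule has_derivative_eq_rhs, (rule derivative_intros has_derivative_n_nth that)+) (simp add: fun_eq_iff)
    from has_derivative_eq_0[OF open_V that this, of "axis i 1"]
    have "n u $ 1 * partial i n u $ 1 + n u $ 2 * partial i n u $ 2 = 0"
      using unit by simp
    with unit[OF that] show "partial i n u $ 1 = - \<theta> i u * n u $ 2" "partial i n u $ 2 = \<theta> i u * n u $ 1"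
      unfolding \<theta>_def by algebra+
  qed
  have q: "D i n u \<bullet> e j u = - \<theta> i u * a j u - 2 * n u $ 1 * n u $ 2 * a i u * z j u" if "u \<in> V" for i j u
    using unit[OF that] unfolding frame_nabla_def inner_3
    by (simp add: dn dn3 ea n3 that z_def) algebra
  have ee: "e i u \<bullet> e j u = a i u * a j u + z i u * z j u" if "u \<in> V" for i j u
    using unit[OF that] unfolding inner_3 by (simp add: ea that z_def) algebra
  \<comment> \<open>By \<open>ee\<close>, \<open>a\<close> and \<open>z\<close> form an orthonormal
    coframe of the surface and \<open>\<delta>\<close> is their wedge product, a signed area
    density.\<close>
  have gram: "gram (e 1 u) (e 2 u) = (\<delta> u)\<^sup>2" if "u \<in> V" for u
    unfolding gram_def ee[OF that] \<delta>_def by (simp add: power2_eq_square algebra_simps)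
  then have \<delta>: "\<delta> u \<noteq> 0" if "u \<in> V" for u
    using gram_nonzero that by fastforce
  \<comment> \<open>Symmetry gives the wedge product of \<open>\<theta>\<close> with
    \<open>a\<close>, the trace that with \<open>z\<close>. These fix the coefficients at
    \<open>z\<close> and at \<open>a\<close> respectively, by Cramer's rule with determinant
    \<open>\<delta> u\<close>.\<close>
  have \<theta>: "\<theta> i u - 2 * c * a i u - 2 * n u $ 1 * n u $ 2 * z i u = 0" if "u \<in> V" for i u
  proof -
    have sym: "\<theta> 1 u * a 2 u - \<theta> 2 u * a 1 u = - 2 * n u $ 1 * n u $ 2 * \<delta> u"
      using Dn_symmetric[OF that, of 1 2] unfolding q[OF that] \<delta>_def by (simp add: algebra_simps)
    have "\<delta> u * (\<theta> 1 u * z 2 u - \<theta> 2 u * z 1 u) = - adj_trace (\<lambda>i. e i u) (\<lambda>i j. D i n u \<bullet> e j u)"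
      unfolding adj_trace_def q[OF that] ee[OF that] \<delta>_def by (simp add: algebra_simps)
    also have "\<dots> = \<delta> u * (2 * c * \<delta> u)"
      using trace[OF that] gram[OF that] by (simp add: power2_eq_square)
    finally have tr: "\<theta> 1 u * z 2 u - \<theta> 2 u * z 1 u = 2 * c * \<delta> u"
      using \<delta>[OF that] by simp
    have "\<delta> u * (\<theta> 1 u - 2 * c * a 1 u - 2 * n u $ 1 * n u $ 2 * z 1 u)
        = a 1 u * (\<theta> 1 u * z 2 u - \<theta> 2 u * z 1 u - 2 * c * \<delta> u)
        - z 1 u * (\<theta> 1 u * a 2 u - \<theta> 2 u * a 1 u + 2 * n u $ 1 * n u $ 2 * \<delta> u)"
      unfolding \<delta>_def by (simp add: algebra_simps)
    moreover have "\<delta> u * (\<theta> 2 u - 2 * c * a 2 u - 2 * n u $ 1 * n u $ 2 * z 2 u)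
        = a 2 u * (\<theta> 1 u * z 2 u - \<theta> 2 u * z 1 u - 2 * c * \<delta> u)
        - z 2 u * (\<theta> 1 u * a 2 u - \<theta> 2 u * a 1 u + 2 * n u $ 1 * n u $ 2 * \<delta> u)"
      unfolding \<delta>_def by (simp add: algebra_simps)
    ultimately show ?thesis
      using \<delta>[OF that] exhaust_2[of i] sym tr by auto
  qed
  show ?thesis
  proof (rule ccontr)
    assume "c \<noteq> 0"
    have C: "n u $ 2 * n u $ 2 - n u $ 1 * n u $ 1 = 0" if u: "u \<in> V" for u
    proof -
      have nn: "((\<lambda>x. partial i n x $ k) has_derivative (\<lambda>v. frechet_derivative (partial i n) (at u) v $ k)) (at u)" for i k
        by (intro bounded_linear.has_derivative[OF bounded_linear_vec_nth] frechet_derivative_works[THEN iffD1] dn_differentiable u)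
      have de: "((\<lambda>x. e i x $ k) has_derivative (\<lambda>v. frechet_derivative (e i) (at u) v $ k)) (at u)" for i k
        by (intro bounded_linear.has_derivative[OF bounded_linear_vec_nth] frechet_derivative_works[THEN iffD1] e_differentiable u)
      have "((\<lambda>x. \<theta> i x - 2 * c * a i x - 2 * n x $ 1 * n x $ 2 * z i x) has_derivative
        (\<lambda>v. frechet_derivative n (at u) v $ 1 * partial i n u $ 2 + n u $ 1 * frechet_derivative (partial i n) (at u) v $ 2
          - frechet_derivative n (at u) v $ 2 * partial i n u $ 1 - n u $ 2 * frechet_derivative (partial i n) (at u) v $ 1
          - 2 * c * (frechet_derivative (e i) (at u) v $ 1 * n u $ 2 + e i u $ 1 * frechet_derivative n (at u) v $ 2
              - frechet_derivative (e i) (at u) v $ 2 * n u $ 1 - e i u $ 2 * frechet_derivative n (at u) v $ 1)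
          - 2 * (frechet_derivative n (at u) v $ 1 * n u $ 2 + n u $ 1 * frechet_derivative n (at u) v $ 2) * e i u $ 3
          - 2 * n u $ 1 * n u $ 2 * frechet_derivative (e i) (at u) v $ 3)) (at u)" for i
        unfolding \<theta>_def a_def z_def
        by (rule has_derivative_eq_rhs, (rule has_derivative_add has_derivative_diff has_derivative_mult has_derivative_const
             nn de has_derivative_n_nth[OF u])+) (simp add: fun_eq_iff algebra_simps)
      from has_derivative_eq_0[OF open_V u this \<theta>]
      have d\<theta>: "partial j n u $ 1 * partial i n u $ 2 + n u $ 1 * partial j (partial i n) u $ 2
          - partial j n u $ 2 * partial i n u $ 1 - n u $ 2 * partial j (partial i n) u $ 1
          - 2 * c * (partial j (e i) u $ 1 * n u $ 2 + e i u $ 1 * partial j n u $ 2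
              - partial j (e i) u $ 2 * n u $ 1 - e i u $ 2 * partial j n u $ 1)
          - 2 * (partial j n u $ 1 * n u $ 2 + n u $ 1 * partial j n u $ 2) * e i u $ 3
          - 2 * n u $ 1 * n u $ 2 * partial j (e i) u $ 3 = 0" for i j .
      have sym: "partial 1 (partial 2 n) u = partial 2 (partial 1 n) u"
        by (rule frechet_derivative_symmetric_vec[OF open_V n_C2 u])
      have t: "partial 1 (e 2) u + sol_connection (e 1 u) (e 2 u) = partial 2 (e 1) u + sol_connection (e 2 u) (e 1 u)"
        using torsion_free[OF u, of 1 2] by (simp add: frame_nabla_def)
      have t1: "partial 1 (e 2) u $ 1 = partial 2 (e 1) u $ 1 + e 2 u $ 1 * e 1 u $ 3 - e 1 u $ 1 * e 2 u $ 3"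
        and t2: "partial 1 (e 2) u $ 2 = partial 2 (e 1) u $ 2 - e 2 u $ 2 * e 1 u $ 3 + e 1 u $ 2 * e 2 u $ 3"
        and t3: "partial 1 (e 2) u $ 3 = partial 2 (e 1) u $ 3"
        using arg_cong[OF t, of "\<lambda>v. v $ 1"] arg_cong[OF t, of "\<lambda>v. v $ 2"] arg_cong[OF t, of "\<lambda>v. v $ 3"]
        by (simp_all add: algebra_simps)
      txt \<open>\<open>d\<theta>\<close> after the terms cancelling by \<open>dn\<close> and \<open>ea\<close>; antisymmetrizing it in \<open>i\<close>, \<open>j\<close> expresses that
        the 1-form \<open>\<theta>\<close> is closed.\<close>
      define L where "L j i = n u $ 1 * partial j (partial i n) u $ 2 - n u $ 2 * partial j (partial i n) u $ 1
          - 2 * c * (partial j (e i) u $ 1 * n u $ 2 - partial j (e i) u $ 2 * n u $ 1)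
          + 2 * (n u $ 2 * n u $ 2 - n u $ 1 * n u $ 1) * \<theta> j u * z i u
          - 2 * n u $ 1 * n u $ 2 * partial j (e i) u $ 3" for i j
      have L: "L j i = 0" for i j
        using d\<theta>[of j i] by (simp add: L_def dn[OF u] ea[OF u] z_def algebra_simps)
      \<comment> \<open>Of the factor 6, 2 comes from the exterior derivative of \<open>a\<close>
        (through \<open>t1\<close> and \<open>t2\<close>) and 4 from differentiating the coefficient
        of \<open>z\<close>, where the subtracted bracket replaces \<open>\<theta>\<close> by its
        value.\<close>
      have "6 * c * (n u $ 2 * n u $ 2 - n u $ 1 * n u $ 1) * \<delta> u
        = L 1 2 - L 2 1 - 2 * (n u $ 2 * n u $ 2 - n u $ 1 * n u $ 1)
          * (z 2 u * (\<theta> 1 u - 2 * c * a 1 u - 2 * n u $ 1 * n u $ 2 * z 1 u)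
            - z 1 u * (\<theta> 2 u - 2 * c * a 2 u - 2 * n u $ 1 * n u $ 2 * z 2 u))"
        unfolding L_def sym t1 t2 t3 ea[OF u] \<delta>_def z_def[symmetric] by (simp add: algebra_simps)
      also have "\<dots> = 0"
        by (simp add: L \<theta>[OF u])
      finally have "6 * c * (n u $ 2 * n u $ 2 - n u $ 1 * n u $ 1) * \<delta> u = 0" .
      then show ?thesis
        using \<delta>[OF u] \<open>c \<noteq> 0\<close> by simp
    qed
    obtain u where u: "u \<in> V" using assms(3) by blast
    \<comment> \<open>In terms of the angle: cos (2 t) vanishes on all of \<open>V\<close>, hence so
      does its differential - 2 sin (2 t) dt, while sin (2 t) is nonzero.\<close>
    have "((\<lambda>x. n x $ 2 * n x $ 2 - n x $ 1 * n x $ 1) has_derivative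
      (\<lambda>v. 2 * (n u $ 2 * frechet_derivative n (at u) v $ 2 - n u $ 1 * frechet_derivative n (at u) v $ 1))) (at u)"
      by (rule has_derivative_eq_rhs, (rule derivative_intros has_derivative_n_nth u)+) (simp add: fun_eq_iff algebra_simps)
    from has_derivative_eq_0[OF open_V u this C]
    have "2 * (n u $ 2 * partial i n u $ 2 - n u $ 1 * partial i n u $ 1) = 0" for i .
    then have "4 * n u $ 1 * n u $ 2 * \<theta> i u = 0" for i
      unfolding dn[OF u] by (simp add: algebra_simps)
    moreover have "n u $ 1 * n u $ 2 \<noteq> 0"
      using C[OF u] unit[OF u] by auto
    ultimately have \<theta>0: "\<theta> i u = 0" for i
      by auto
    \<comment> \<open>The wedge product of the formula for \<open>\<theta>\<close> with
      \<open>z\<close> removes the term with \<open>n u $ 1 * n u $ 2\<close>.\<close>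
    have "2 * c * \<delta> u = z 1 u * (\<theta> 2 u - 2 * c * a 2 u - 2 * n u $ 1 * n u $ 2 * z 2 u)
      - z 2 u * (\<theta> 1 u - 2 * c * a 1 u - 2 * n u $ 1 * n u $ 2 * z 1 u) + z 2 u * \<theta> 1 u - z 1 u * \<theta> 2 u"
      unfolding \<delta>_def by (simp add: algebra_simps)
    also have "\<dots> = 0"
      unfolding \<theta>[OF u] unfolding \<theta>0 by simp
    finally have "2 * c * \<delta> u = 0" .
    then show False
      using \<open>c \<noteq> 0\<close> \<delta>[OF u] by simp
  qed
qed

lemma constant_mean_curvature_imp_minimal:
  assumes trace: "\<And>u. u \<in> V \<Longrightarrow> adj_trace (\<lambda>i. e i u) (\<lambda>i j. D i n u \<bullet> e j u) = - 2 * c * gram (e 1 u) (e 2 u)"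
    and "\<And>u m. u \<in> V \<Longrightarrow> adj_trace (\<lambda>i. e i u) (\<lambda>i j. D i (D j n) u \<bullet> e m u - D m n u \<bullet> D i (e j) u
      - sol_curvature (e i u) (n u) (e j u) \<bullet> e m u) = 0"
    and "V \<noteq> {}"
  shows "c = 0"
proof (cases "\<forall>u\<in>V. n u $ 3 = 0")
  case True
  then show ?thesis using vertical_imp_minimal[OF trace] assms(3) by blast
next
  case False
  then obtain u where "u \<in> V" "n u $ 3 \<noteq> 0" by blast
  then show ?thesis
    using horizontal_imp_minimal[OF trace normal_tangent_vertical[OF trace]] assms(2) by blast
qed

end

section \<open>Immersed surfaces in Sol3\<close>

lemma matrix_inv_2:
  fixes A :: "real^2^2"
  assumes "A $ 1 $ 1 * A $ 2 $ 2 - A $ 1 $ 2 * A $ 2 $ 1 \<noteq> 0"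
  shows "matrix_inv A = (1 / (A $ 1 $ 1 * A $ 2 $ 2 - A $ 1 $ 2 * A $ 2 $ 1)) *\<^sub>R
    vector [vector [A $ 2 $ 2, - A $ 1 $ 2], vector [- A $ 2 $ 1, A $ 1 $ 1]]"
  by (rule matrix_inv_unique; use assms in \<open>simp add: vec_eq_iff forall_2 matrix_matrix_mult_def sum_2 mat_def\<close>;
      simp add: divide_simps; simp add: algebra_simps)

text \<open>The weights are exponentials of plus or minus the third coordinate, so negating the
  point inverts them. This recovers differentiability of a field from that of its frame
  components.\<close>

lemma sol_coframe_inverse: "sol_coframe (- p) (sol_coframe p v) = v"
  by (simp add: vec_eq_iff forall_3 flip: mult.assoc exp_add)

lemma Ck_on_sol_coframe:
  fixes r W :: "'a::real_normed_vector \<Rightarrow> real^3"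
  assumes "open V" "Ck_on k V r" "Ck_on k V W"
  shows "Ck_on k V (\<lambda>x. sol_coframe (r x) (W x))"
proof -
  have nth: "Ck_on k V (\<lambda>x. r x $ i)" "Ck_on k V (\<lambda>x. - r x $ i)" "Ck_on k V (\<lambda>x. W x $ i)" for i
    using Ck_on_bounded_linear[OF assms(1) bounded_linear_vec_nth] assms(2,3)
      Ck_on_bounded_linear[OF assms(1) bounded_linear_minus[OF bounded_linear_vec_nth]] by auto
  show ?thesis
    unfolding sol_coframe_axis
    by (intro Ck_on_add Ck_on_bounded_bilinear[OF _ bounded_bilinear_scaleR] Ck_on_exp Ck_on_const nth assms(1))
qed

lemma metric_trace_linear:
  "linear L \<Longrightarrow> L (metric_trace h u B) = metric_trace h u (\<lambda>i j. L (B i j))"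
  by (simp add: metric_trace_def linear_sum linear_cmul o_def)

lemma vec_2_eq: "v = v $ 1 *\<^sub>R axis 1 1 + v $ 2 *\<^sub>R axis 2 1" for v :: "real^2"
  by (simp add: vec_eq_iff forall_2 axis_def)

locale sol_immersion =
  fixes V :: "(real^2) set" and r \<xi> :: "real^2 \<Rightarrow> real^3"
  assumes open_V: "open V"
    and smooth_r: "smooth_on V r"
    and smooth_\<xi>: "smooth_on V \<xi>"
    and inj_dr: "u \<in> V \<Longrightarrow> inj (frechet_derivative r (at u))"
    and \<xi>_unit: "u \<in> V \<Longrightarrow> metric_inner sol_metric (r u) (\<xi> u) (\<xi> u) = 1"
    and \<xi>_normal: "u \<in> V \<Longrightarrow> metric_inner sol_metric (r u) (\<xi> u) (frechet_derivative r (at u) v) = 0"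
begin

definition e :: "2 \<Rightarrow> real^2 \<Rightarrow> real^3" where "e i u = sol_coframe (r u) (partial i r u)"
definition n :: "real^2 \<Rightarrow> real^3" where "n u = sol_coframe (r u) (\<xi> u)"

abbreviation "D \<equiv> frame_nabla e"

lemma Ck_partial_r: "Ck_on k V (partial i r)"
  using smooth_r unfolding smooth_on_def by (metis Ck_on.simps(2))

lemma differentiable_r: "u \<in> V \<Longrightarrow> r differentiable (at u)"
  and differentiable_\<xi>: "u \<in> V \<Longrightarrow> \<xi> differentiable (at u)"
  and differentiable_partial_r: "u \<in> V \<Longrightarrow> partial i r differentiable (at u)"
  using smooth_r smooth_\<xi> Ck_partial_r[of 1 i] unfolding smooth_on_def by (metis Ck_on.simps(2) One_nat_def)+

lemma linear_dr: "u \<in> V \<Longrightarrow> linear (frechet_derivative r (at u))"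
  by (rule linear_frechet_derivative[OF differentiable_r])

lemma coframe_dr:
  assumes "u \<in> V"
  shows "sol_coframe (r u) (frechet_derivative r (at u) v) = v $ 1 *\<^sub>R e 1 u + v $ 2 *\<^sub>R e 2 u"
  unfolding e_def
  by (subst vec_2_eq[of v], simp only: linear_add[OF linear_dr[OF assms]] linear_cmul[OF linear_dr[OF assms]]
      linear_add[OF linear_sol_coframe] linear_cmul[OF linear_sol_coframe])

lemma coframe_nabla_along:
  assumes "u \<in> V" "W differentiable (at u)"
  shows "sol_coframe (r u) (nabla_along sol_metric r X W u)
    = X u $ 1 *\<^sub>R D 1 (\<lambda>x. sol_coframe (r x) (W x)) u + X u $ 2 *\<^sub>R D 2 (\<lambda>x. sol_coframe (r x) (W x)) u"
proof -
  interpret sc: bounded_bilinear sol_connection by (rule bounded_bilinear_sol_connection)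
  have "(\<lambda>x. sol_coframe (r x) (W x)) differentiable (at u)"
    using has_derivative_sol_coframe[of r _ u W] differentiable_r assms unfolding differentiable_def by blast
  then have L: "linear (frechet_derivative (\<lambda>x. sol_coframe (r x) (W x)) (at u))"
    by (rule linear_frechet_derivative)
  have "frechet_derivative (\<lambda>x. sol_coframe (r x) (W x)) (at u) (X u)
    = X u $ 1 *\<^sub>R partial 1 (\<lambda>x. sol_coframe (r x) (W x)) u + X u $ 2 *\<^sub>R partial 2 (\<lambda>x. sol_coframe (r x) (W x)) u"
    by (subst vec_2_eq[of "X u"]) (simp only: linear_add[OF L] linear_cmul[OF L])
  then show ?thesis
    unfolding sol_coframe_nabla_along[OF differentiable_r[OF assms(1)] assms(2)] coframe_dr[OF assms(1)] frame_nabla_def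
    by (simp add: sc.add_left sc.scaleR_left scaleR_add_right)
qed

lemma coframe_nabla_coord:
  assumes "u \<in> V" "W differentiable (at u)"
  shows "sol_coframe (r u) (nabla_along sol_metric r (coord_field i) W u) = D i (\<lambda>x. sol_coframe (r x) (W x)) u"
  using coframe_nabla_along[OF assms, of "coord_field i"] exhaust_2[of i] by (auto simp: axis_def)

text \<open>A zero Gram determinant would annihilate the part of \<open>e 1 u\<close> orthogonal to
  \<open>e 2 u\<close>, a linear dependence excluded by injectivity of the differential.\<close>

lemma gram_e_nonzero:
  assumes u: "u \<in> V"
  shows "gram (e 1 u) (e 2 u) \<noteq> 0"
proof
  assume 0: "gram (e 1 u) (e 2 u) = 0"
  have dr0: "v = 0" if "v $ 1 *\<^sub>R e 1 u + v $ 2 *\<^sub>R e 2 u = 0" for v :: "real^2"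
  proof -
    have "frechet_derivative r (at u) v = 0"
      using that coframe_dr[OF u, of v] sol_coframe_eq_0_iff by metis
    then show "v = 0"
      using inj_dr[OF u] linear_dr[OF u] linear_injective_0 by blast
  qed
  let ?x = "(e 2 u \<bullet> e 2 u) *\<^sub>R e 1 u - (e 1 u \<bullet> e 2 u) *\<^sub>R e 2 u"
  have "?x \<bullet> ?x = (e 2 u \<bullet> e 2 u) * gram (e 1 u) (e 2 u)"
    by (simp add: gram_def inner_diff_left inner_diff_right inner_commute[of "e 2 u" "e 1 u"] power2_eq_square algebra_simps)
  then have "?x = 0" using 0 by simp
  then have "(vector [e 2 u \<bullet> e 2 u, - (e 1 u \<bullet> e 2 u)] :: real^2) = 0"
    by (intro dr0) simp
  then have "e 2 u \<bullet> e 2 u = 0"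
    by (metis vector_2(1) zero_index)
  then have "axis 2 1 = (0 :: real^2)"
    by (intro dr0) (simp add: axis_def)
  then show False by simp
qed

sublocale S: sol_surface V e n
proof
  fix u assume u: "u \<in> V"
  have "Ck_on 1 V (e i)" for i
    using smooth_r unfolding e_def smooth_on_def by (intro Ck_on_sol_coframe open_V Ck_partial_r) auto
  then show "e i differentiable (at u)" for i
    using u by simp
  have "D i (e j) u = sol_coframe (r u) (nabla_along sol_metric r (coord_field i) (partial j r) u)" for i j
    by (simp add: coframe_nabla_coord[OF u differentiable_partial_r[OF u]] e_def[abs_def])
  moreover have "nabla_along sol_metric r (coord_field i) (partial j r) u
      = nabla_along sol_metric r (coord_field j) (partial i r) u" for i j
    using frechet_derivative_symmetric_vec[OF open_V _ u, of r "axis j 1" "axis i 1"] smooth_r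
    by (simp add: nabla_along_def smooth_on_def christoffel_form_sol algebra_simps)
  ultimately show "D i (e j) u = D j (e i) u" for i j
    by metis
  show "n u \<bullet> n u = 1"
    using \<xi>_unit[OF u] by (simp add: n_def metric_inner_sol)
  show "n u \<bullet> e i u = 0" for i
    using \<xi>_normal[OF u] by (simp add: n_def e_def metric_inner_sol)
  show "gram (e 1 u) (e 2 u) \<noteq> 0"
    by (rule gram_e_nonzero[OF u])
next
  show "open V" by (rule open_V)
  show "Ck_on 2 V n"
    using smooth_r smooth_\<xi> unfolding n_def[abs_def] smooth_on_def by (intro Ck_on_sol_coframe open_V) auto
qed

section \<open>Tangential projection and shape operator\<close>

lemma eq_if_inner_eq:
  assumes "u \<in> V" "\<And>i. x \<bullet> e i u = y \<bullet> e i u" "x \<bullet> n u = y \<bullet> n u"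
  shows "x = y"
proof -
  have "(x - y) \<bullet> (x - y) = 0"
    using adj_trace_inner[of "n u" "\<lambda>i. e i u" "x - y" "x - y"] assms
    by (simp add: S.n_unit S.n_normal S.gram_nonzero inner_diff_left adj_trace_def)
  then show ?thesis by simp
qed

text \<open>The solution of the normal equations: coordinates of the tangential projection of the
  frame vector \<open>y\<close>. It is the explicit witness for \<open>tangent_part\<close> and
  \<open>shape_operator\<close>, and also yields the induced Levi-Civita connection.\<close>

definition tangent_coords :: "real^3 \<Rightarrow> real^2 \<Rightarrow> real^2"
  where "tangent_coords y u = vector
    [((e 2 u \<bullet> e 2 u) * (y \<bullet> e 1 u) - (e 1 u \<bullet> e 2 u) * (y \<bullet> e 2 u)) / gram (e 1 u) (e 2 u),
     ((e 1 u \<bullet> e 1 u) * (y \<bullet> e 2 u) - (e 1 u \<bullet> e 2 u) * (y \<bullet> e 1 u)) / gram (e 1 u) (e 2 u)]"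

lemma tangent_coords_inner:
  assumes "u \<in> V"
  shows "sol_coframe (r u) (frechet_derivative r (at u) (tangent_coords y u)) \<bullet> e i u = y \<bullet> e i u"
proof -
  let ?g = "gram (e 1 u) (e 2 u)"
  have "?g *\<^sub>R (sol_coframe (r u) (frechet_derivative r (at u) (tangent_coords y u)))
    = ((e 2 u \<bullet> e 2 u) * (y \<bullet> e 1 u) - (e 1 u \<bullet> e 2 u) * (y \<bullet> e 2 u)) *\<^sub>R e 1 u
    + ((e 1 u \<bullet> e 1 u) * (y \<bullet> e 2 u) - (e 1 u \<bullet> e 2 u) * (y \<bullet> e 1 u)) *\<^sub>R e 2 u"
    unfolding coframe_dr[OF assms] tangent_coords_def using S.gram_nonzero[OF assms] by (simp add: scaleR_add_right)
  from arg_cong[OF this, of "\<lambda>v. v \<bullet> e i u"] have "?g * (sol_coframe (r u) (frechet_derivative r (at u) (tangent_coords y u)) \<bullet> e i u)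
    = ((e 2 u \<bullet> e 2 u) * (y \<bullet> e 1 u) - (e 1 u \<bullet> e 2 u) * (y \<bullet> e 2 u)) * (e 1 u \<bullet> e i u)
    + ((e 1 u \<bullet> e 1 u) * (y \<bullet> e 2 u) - (e 1 u \<bullet> e 2 u) * (y \<bullet> e 1 u)) * (e 2 u \<bullet> e i u)"
    by (simp only: inner_add_left inner_scaleR_left)
  also have "\<dots> = ?g * (y \<bullet> e i u)"
    using exhaust_2[of i] by (auto simp: gram_def power2_eq_square inner_commute[of "e 2 u" "e 1 u"] algebra_simps)
  finally show ?thesis using S.gram_nonzero[OF assms] by simp
qed

text \<open>As \<open>tangent_part\<close> is a definite description, its vanishing carries
  information only once existence and uniqueness of the projection are established.\<close>

lemma tangent_part_eq_0_imp:
  assumes u: "u \<in> V" and 0: "tangent_part sol_metric r u w = 0"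
  shows "sol_coframe (r u) w \<bullet> e i u = 0"
proof -
  let ?P = "\<lambda>t. t \<in> range (frechet_derivative r (at u)) \<and>
    (\<forall>v. metric_inner sol_metric (r u) (w - t) (frechet_derivative r (at u) v) = 0)"
  let ?t = "frechet_derivative r (at u) (tangent_coords (sol_coframe (r u) w) u)"
  have "?P ?t"
    using tangent_coords_inner[OF u, of "sol_coframe (r u) w"]
    by (auto simp: metric_inner_sol coframe_dr[OF u, of "_ :: real^2"] linear_diff[OF linear_sol_coframe] inner_diff_left inner_add_right)
  moreover have "t = t'" if t: "?P t" "?P t'" for t t'
  proof -
    obtain a a' where a: "t = frechet_derivative r (at u) a" "t' = frechet_derivative r (at u) a'"
      using t by blast
    have "metric_inner sol_metric (r u) (w - t') (t - t') - metric_inner sol_metric (r u) (w - t) (t - t') = 0"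
      using t unfolding a linear_diff[OF linear_dr[OF u], symmetric] by simp
    then have "sol_coframe (r u) (t - t') \<bullet> sol_coframe (r u) (t - t') = 0"
      by (simp add: metric_inner_sol linear_diff[OF linear_sol_coframe] flip: inner_diff_left)
    then show "t = t'"
      by (simp add: sol_coframe_eq_0_iff)
  qed
  ultimately have "?P (tangent_part sol_metric r u w)"
    unfolding tangent_part_def by (intro theI[of ?P]) blast+
  then show ?thesis
    using 0 by (simp add: metric_inner_sol e_def)
qed

lemma trace_shape_operator:
  assumes u: "u \<in> V"
  shows "gram (e 1 u) (e 2 u) * trace (matrix (shape_operator sol_metric r \<xi> u))
    = - adj_trace (\<lambda>i. e i u) (\<lambda>i j. D i n u \<bullet> e j u)"
proof -
  have "shape_operator sol_metric r \<xi> u (axis i 1) = tangent_coords (- D i n u) u" for i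
    unfolding shape_operator_def
  proof (rule the_equality)
    have "sol_coframe (r u) (- nabla_along sol_metric r (coord_field i) \<xi> u) = - D i n u"
      using coframe_nabla_coord[OF u differentiable_\<xi>[OF u], of i]
      by (simp add: linear_neg[OF linear_sol_coframe] n_def[abs_def])
    also have "\<dots> = sol_coframe (r u) (frechet_derivative r (at u) (tangent_coords (- D i n u) u))"
      by (rule eq_if_inner_eq[OF u])
        (simp_all only: tangent_coords_inner[OF u], simp add: coframe_dr[OF u] S.Dn_normal[OF u] inner_add_left inner_commute[of "e _ u"] S.n_normal[OF u])
    finally have "sol_coframe (r u) (- nabla_along sol_metric r (coord_field i) \<xi> u
        - frechet_derivative r (at u) (tangent_coords (- D i n u) u)) = 0"
      by (simp add: linear_diff[OF linear_sol_coframe])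
    then show *: "frechet_derivative r (at u) (tangent_coords (- D i n u) u) = - nabla_along sol_metric r (coord_field i) \<xi> u"
      by (simp add: sol_coframe_eq_0_iff)
    fix w assume "frechet_derivative r (at u) w = - nabla_along sol_metric r (coord_field i) \<xi> u"
    with * show "w = tangent_coords (- D i n u) u"
      using inj_dr[OF u] by (metis injD)
  qed
  then show ?thesis
    using S.gram_nonzero[OF u]
    by (simp add: trace_def sum_2 matrix_def tangent_coords_def adj_trace_def add_divide_distrib[symmetric]) (simp add: algebra_simps)
qed

section \<open>Induced metric, Gauss formula and tension field\<close>

abbreviation "h \<equiv> induced_metric sol_metric r"

lemma induced_metric_nth: "h u $ i $ j = e i u \<bullet> e j u"
  by (simp add: induced_metric_def metric_inner_sol e_def)

lemma matrix_inv_h: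
  assumes "u \<in> V"
  shows "matrix_inv (h u) = (1 / gram (e 1 u) (e 2 u)) *\<^sub>R
    vector [vector [e 2 u \<bullet> e 2 u, - (e 1 u \<bullet> e 2 u)], vector [- (e 1 u \<bullet> e 2 u), e 1 u \<bullet> e 1 u]]"
  using matrix_inv_2[of "h u"] S.gram_nonzero[OF assms]
  by (simp add: induced_metric_nth gram_def power2_eq_square inner_commute[of "e 2 u" "e 1 u"])

lemma metric_trace_h:
  assumes "u \<in> V"
  shows "gram (e 1 u) (e 2 u) * metric_trace h u B = adj_trace (\<lambda>i. e i u) B"
  using S.gram_nonzero[OF assms]
  by (simp add: metric_trace_def matrix_inv_h[OF assms] sum_2 adj_trace_def distrib_left) (simp add: algebra_simps)

text \<open>The Gauss formula. In the Koszul expression, metric compatibility and torsion-freeness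
  collapse the three derivatives of the induced metric to
  \<open>D i (e j) u \<bullet> e l u\<close>.\<close>

lemma coframe_dr_levi_civita:
  assumes u: "u \<in> V"
  shows "sol_coframe (r u) (frechet_derivative r (at u) (levi_civita h (coord_field i) (coord_field j) u))
    = D i (e j) u - (D i (e j) u \<bullet> n u) *\<^sub>R n u"
proof (rule eq_if_inner_eq[OF u])
  fix l
  define T where "T l = (partial i (\<lambda>q. h q $ j $ l) u + partial j (\<lambda>q. h q $ i $ l) u - partial l (\<lambda>q. h q $ i $ j) u) / 2" for l
  have T: "T l = D i (e j) u \<bullet> e l u" for l
    unfolding T_def induced_metric_nth
    by (simp add: S.partial_inner S.e_differentiable u S.torsion_free[OF u, of j i] S.torsion_free[OF u, of l] inner_commute[of "e _ u"])
  have lc: "levi_civita h (coord_field i) (coord_field j) u $ k = (\<Sum>l\<in>UNIV. matrix_inv (h u) $ k $ l * T l)" for k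
  proof -
    have "levi_civita h (coord_field i) (coord_field j) u $ k = christoffel h k i j u"
      using exhaust_2[of i] exhaust_2[of j]
      by (auto simp: levi_civita_def christoffel_form_def frechet_derivative_const sum_2 axis_def)
    then show ?thesis
      by (simp add: christoffel_def T_def sum_divide_distrib)
  qed
  have "levi_civita h (coord_field i) (coord_field j) u = tangent_coords (D i (e j) u) u"
    by (simp add: vec_eq_iff forall_2 lc sum_2 T tangent_coords_def matrix_inv_h[OF u] diff_divide_distrib)
  then show "sol_coframe (r u) (frechet_derivative r (at u) (levi_civita h (coord_field i) (coord_field j) u)) \<bullet> e l u
    = (D i (e j) u - (D i (e j) u \<bullet> n u) *\<^sub>R n u) \<bullet> e l u"
    by (simp add: tangent_coords_inner[OF u] inner_diff_left S.n_normal[OF u])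
next
  show "sol_coframe (r u) (frechet_derivative r (at u) (levi_civita h (coord_field i) (coord_field j) u)) \<bullet> n u
    = (D i (e j) u - (D i (e j) u \<bullet> n u) *\<^sub>R n u) \<bullet> n u"
    by (simp add: coframe_dr[OF u] inner_add_left inner_diff_left inner_commute[of "e _ u"] S.n_normal[OF u] S.n_unit[OF u])
qed

text \<open>By the Gauss formula the Levi-Civita term cancels the tangent part of
  \<open>D i (e j) u\<close>, which leaves a multiple of \<open>n u\<close>.\<close>

lemma coframe_tension:
  assumes u: "u \<in> V"
  shows "gram (e 1 u) (e 2 u) *\<^sub>R sol_coframe (r u) (tension sol_metric r u)
    = (- adj_trace (\<lambda>i. e i u) (\<lambda>i j. D i n u \<bullet> e j u)) *\<^sub>R n u"
proof -
  have "sol_coframe (r u) (nabla_d sol_metric r (coord_field i) (coord_field j) u) = (- (D i n u \<bullet> e j u)) *\<^sub>R n u" for i j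
    using coframe_nabla_coord[OF u differentiable_partial_r[OF u], of i j]
    by (simp add: nabla_d_def linear_diff[OF linear_sol_coframe] coframe_dr_levi_civita[OF u]
        S.Dn_inner_e[OF u] inner_commute[of "n u"] flip: e_def)
  then have "sol_coframe (r u) (tension sol_metric r u) = metric_trace h u (\<lambda>i j. (- (D i n u \<bullet> e j u)) *\<^sub>R n u)"
    unfolding tension_def by (simp add: metric_trace_linear[OF linear_sol_coframe])
  also have "\<dots> = metric_trace h u (\<lambda>i j. - (D i n u \<bullet> e j u)) *\<^sub>R n u"
    by (rule metric_trace_linear[symmetric]) (auto intro!: linearI simp: scaleR_add_left)
  finally show ?thesis
    by (simp add: metric_trace_h[OF u] adj_trace_minus)
qed

lemma constant_mean_curvature_biconservative:
  assumes H: "\<And>u. u \<in> V \<Longrightarrow> trace (matrix (shape_operator sol_metric r \<xi> u)) / 2 = c"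
    and bicons: "\<And>u. u \<in> V \<Longrightarrow> tangent_part sol_metric r u (bitension sol_metric r u) = 0"
    and "V \<noteq> {}"
  shows "c = 0"
proof (rule ccontr)
  assume c: "c \<noteq> 0"
  let ?\<tau> = "tension sol_metric r"
  have trace: "adj_trace (\<lambda>i. e i u) (\<lambda>i j. D i n u \<bullet> e j u) = - 2 * c * gram (e 1 u) (e 2 u)" if "u \<in> V" for u
    using trace_shape_operator[OF that] H[OF that] by (simp add: field_simps)
  have c\<tau>: "sol_coframe (r u) (?\<tau> u) = (2 * c) *\<^sub>R n u" if "u \<in> V" for u
  proof -
    have "gram (e 1 u) (e 2 u) *\<^sub>R sol_coframe (r u) (?\<tau> u) = gram (e 1 u) (e 2 u) *\<^sub>R (2 * c) *\<^sub>R n u"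
      using coframe_tension[OF that] trace[OF that] by (simp add: mult.commute)
    then show ?thesis using S.gram_nonzero[OF that] unfolding scaleR_cancel_left by blast
  qed
  \<comment> \<open>Differentiability of the tension field and of its covariant derivatives is read
    off from their frame components \<open>(2 * c) *\<^sub>R n x\<close> and
    \<open>(2 * c) *\<^sub>R D j n x\<close> instead of their defining formulas.\<close>
  have coframe_differentiable: "W differentiable (at u)"
    if "u \<in> V" "\<And>x. x \<in> V \<Longrightarrow> sol_coframe (r x) (W x) = Y x" "Y differentiable (at u)" for u W Y
  proof (rule differentiable_cong_open[OF open_V that(1)])
    show "W x = sol_coframe (- r x) (Y x)" if "x \<in> V" for x
      using sol_coframe_inverse that \<open>\<And>x. x \<in> V \<Longrightarrow> sol_coframe (r x) (W x) = Y x\<close> by metis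
    have "(\<lambda>x. - r x) differentiable (at u)"
      using differentiable_r[OF that(1)] by simp
    then show "(\<lambda>x. sol_coframe (- r x) (Y x)) differentiable (at u)"
      using has_derivative_sol_coframe[of "\<lambda>x. - r x" _ u Y] that(3) unfolding differentiable_def by blast
  qed
  have D_cong: "D i W u = D i W' u" if "u \<in> V" "\<And>x. x \<in> V \<Longrightarrow> W x = W' x" for i u W W'
    using frechet_derivative_cong_open[OF open_V that] that by (simp add: frame_nabla_def)
  interpret sc: bounded_bilinear sol_connection by (rule bounded_bilinear_sol_connection)
  have D_scale: "D i (\<lambda>x. a *\<^sub>R W x) u = a *\<^sub>R D i W u" if "W differentiable (at u)" for i u W a
  proof -
    have "((\<lambda>x. a *\<^sub>R W x) has_derivative (\<lambda>v. a *\<^sub>R frechet_derivative W (at u) v)) (at u)"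
      using that by (intro has_derivative_scaleR_right) (simp add: frechet_derivative_works)
    from fun_cong[OF frechet_derivative_at[OF this], of "axis i 1"] show ?thesis
      by (simp add: frame_nabla_def sc.scaleR_right scaleR_add_right)
  qed
  have n2: "(\<lambda>x. (2 * c) *\<^sub>R n x) differentiable (at u)" "(\<lambda>x. (2 * c) *\<^sub>R D j n x) differentiable (at u)" if "u \<in> V" for u j
    using S.n_differentiable[OF that] S.Dn_differentiable[OF that] by simp_all
  have \<tau>_diff: "?\<tau> differentiable (at u)" if "u \<in> V" for u
    by (rule coframe_differentiable[OF that c\<tau> n2(1)[OF that]])
  have D\<tau>: "D i (\<lambda>x. sol_coframe (r x) (?\<tau> x)) u = (2 * c) *\<^sub>R D i n u" if "u \<in> V" for i u
  proof -
    have "D i (\<lambda>x. sol_coframe (r x) (?\<tau> x)) u = D i (\<lambda>x. (2 * c) *\<^sub>R n x) u"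
      by (rule D_cong[OF that c\<tau>])
    then show ?thesis
      by (simp only: D_scale[OF S.n_differentiable[OF that]])
  qed
  have nabla_\<tau>: "sol_coframe (r u) (nabla_along sol_metric r (coord_field j) ?\<tau> u) = (2 * c) *\<^sub>R D j n u" if "u \<in> V" for j u
    by (simp add: coframe_nabla_coord[OF that \<tau>_diff[OF that]] D\<tau>[OF that])
  have "adj_trace (\<lambda>i. e i u) (\<lambda>i j. D i (D j n) u \<bullet> e m u - D m n u \<bullet> D i (e j) u
      - sol_curvature (e i u) (n u) (e j u) \<bullet> e m u) = 0" (is "adj_trace _ ?B = 0") if u: "u \<in> V" for u m
  proof -
    have W: "nabla_along sol_metric r (coord_field j) ?\<tau> differentiable (at u)" for j
      by (rule coframe_differentiable[OF u nabla_\<tau> n2(2)[OF u]])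
    have DW: "D i (\<lambda>x. sol_coframe (r x) (nabla_along sol_metric r (coord_field j) ?\<tau> x)) u
      = D i (\<lambda>x. (2 * c) *\<^sub>R D j n x) u" for i j
      by (rule D_cong[OF u nabla_\<tau>])
    have sq1: "sol_coframe (r u) (nabla_along sol_metric r (coord_field i) (nabla_along sol_metric r (coord_field j) ?\<tau>) u)
      = (2 * c) *\<^sub>R D i (D j n) u" for i j
      unfolding coframe_nabla_coord[OF u W] DW by (rule D_scale[OF S.Dn_differentiable[OF u]])
    \<comment> \<open>Symmetry of the second fundamental form moves the direction \<open>X\<close>
      into the inner product. For the Levi-Civita field the normal remainder of
      \<open>D i (e j) u\<close> then drops out, because \<open>D m n u\<close> is tangent.\<close>
    have sq2: "sol_coframe (r u) (nabla_along sol_metric r X ?\<tau> u) \<bullet> e m u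
      = 2 * c * (D m n u \<bullet> sol_coframe (r u) (frechet_derivative r (at u) (X u)))" for X
      unfolding coframe_nabla_along[OF u \<tau>_diff[OF u]] coframe_dr[OF u] D\<tau>[OF u]
      using S.Dn_symmetric[OF u, of _ m]
      by (simp add: inner_add_left inner_add_right algebra_simps)
    have sq: "sol_coframe (r u) (nabla_square sol_metric r ?\<tau> (coord_field i) (coord_field j) u) \<bullet> e m u
      = 2 * c * (D i (D j n) u \<bullet> e m u - D m n u \<bullet> D i (e j) u)" for i j
      unfolding nabla_square_def linear_diff[OF linear_sol_coframe] sq1 inner_diff_left sq2 coframe_dr_levi_civita[OF u]
      using S.Dn_normal[OF u, of m] by (simp add: inner_diff_right algebra_simps)
    have cv: "sol_coframe (r u) (curvature_at sol_metric (r u) (partial i r u) (?\<tau> u) (partial j r u)) \<bullet> e m u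
      = 2 * c * (sol_curvature (e i u) (n u) (e j u) \<bullet> e m u)" for i j
      unfolding sol_coframe_curvature_at c\<tau>[OF u] e_def[symmetric]
      by (simp add: sol_curvature_inner algebra_simps)
    have lin: "linear (\<lambda>w. sol_coframe (r u) w \<bullet> e m u)"
      by (auto intro!: linearI simp: linear_add[OF linear_sol_coframe] linear_cmul[OF linear_sol_coframe] inner_add_left)
    have "sol_coframe (r u) (bitension sol_metric r u) \<bullet> e m u = 0"
      by (rule tangent_part_eq_0_imp[OF u bicons[OF u]])
    then have "metric_trace h u (\<lambda>i j. 2 * c * (D i (D j n) u \<bullet> e m u - D m n u \<bullet> D i (e j) u))
      - metric_trace h u (\<lambda>i j. 2 * c * (sol_curvature (e i u) (n u) (e j u) \<bullet> e m u)) = 0"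
      unfolding bitension_def rough_laplacian_def
      by (simp only: linear_diff[OF lin] metric_trace_linear[OF lin] sq cv)
    then have "gram (e 1 u) (e 2 u) * metric_trace h u (\<lambda>i j. 2 * c * (D i (D j n) u \<bullet> e m u - D m n u \<bullet> D i (e j) u))
      - gram (e 1 u) (e 2 u) * metric_trace h u (\<lambda>i j. 2 * c * (sol_curvature (e i u) (n u) (e j u) \<bullet> e m u)) = 0"
      by simp
    \<comment> \<open>The whole tangent part carries the factor \<open>2 * c\<close>; cancelling it
      is the reason for arguing by contradiction.\<close>
    then have "2 * c * adj_trace (\<lambda>i. e i u) ?B = 0"
      unfolding metric_trace_h[OF u] by (simp add: adj_trace_def algebra_simps)
    then show ?thesis using c by simp
  qed
  then have "c = 0"
    using S.constant_mean_curvature_imp_minimal[OF trace] assms(3) by blast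
  with c show False by simp
qed

end

theorem proposition3p1:
  fixes M :: "'a topology" and atlas :: "'a chart set"
    and \<phi> \<xi> :: "'a \<Rightarrow> real^3" and f :: "'a \<Rightarrow> real"
  assumes "oriented_surface M atlas"
    and "immersion atlas \<phi>"
    and "unit_normal_field sol_metric atlas \<phi> \<xi>"
    and "mean_curvature_function sol_metric atlas \<phi> \<xi> f"
    and "\<exists>c. \<forall>p\<in>topspace M. f p = c"
    and "biconservative sol_metric atlas \<phi>"
  shows "\<forall>p\<in>topspace M. f p = 0"
proof
  fix p assume p: "p \<in> topspace M"
  obtain c where c: "\<And>q. q \<in> topspace M \<Longrightarrow> f q = c"
    using assms(5) by blast
  obtain U \<psi> where U: "(U, \<psi>) \<in> atlas" "p \<in> U"
    using p assms(1) unfolding oriented_surface_def by blast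
  have chart: "openin M U" "open (\<psi> ` U)" "homeomorphic_map (subtopology M U) (top_of_set (\<psi> ` U)) \<psi>"
    using assms(1) U(1) unfolding oriented_surface_def by blast+
  have UM: "U \<subseteq> topspace M"
    using chart(1) by (rule openin_subset)
  have inj: "inj_on \<psi> U"
    using homeomorphic_imp_injective_map[OF chart(3)] UM by (simp add: Int_absorb1)
  let ?r = "in_chart (U, \<psi>) \<phi>" and ?\<xi> = "in_chart (U, \<psi>) \<xi>"
  have in_chart: "in_chart (U, \<psi>) F (\<psi> q) = F q" if "q \<in> U" for F :: "'a \<Rightarrow> real^3" and q
    using inv_into_f_f[OF inj that] by (simp add: in_chart_def)
  interpret sol_immersion "\<psi> ` U" ?r ?\<xi>
  proof
    show "open (\<psi> ` U)" by (rule chart(2))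
    show "smooth_on (\<psi> ` U) ?r" "\<And>u. u \<in> \<psi> ` U \<Longrightarrow> inj (frechet_derivative ?r (at u))"
      using assms(2) U(1) unfolding immersion_def by blast+
    show "smooth_on (\<psi> ` U) ?\<xi>"
      using assms(3) U(1) unfolding unit_normal_field_def by blast
    have "metric_inner sol_metric (\<phi> q) (\<xi> q) (\<xi> q) = 1"
      "metric_inner sol_metric (\<phi> q) (\<xi> q) (frechet_derivative ?r (at (\<psi> q)) v) = 0" if "q \<in> U" for q v
      using assms(3) U(1) that unfolding unit_normal_field_def by blast+
    then show "metric_inner sol_metric (?r u) (?\<xi> u) (?\<xi> u) = 1"
      "metric_inner sol_metric (?r u) (?\<xi> u) (frechet_derivative ?r (at u) v) = 0" if "u \<in> \<psi> ` U" for u v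
      using that in_chart by auto
  qed
  have "trace (matrix (shape_operator sol_metric ?r ?\<xi> u)) / 2 = c" if u: "u \<in> \<psi> ` U" for u
  proof -
    obtain q where q: "q \<in> U" "u = \<psi> q" using u by blast
    have "f q = trace (matrix (shape_operator sol_metric ?r ?\<xi> (\<psi> q))) / 2"
      using assms(4) U(1) q(1) unfolding mean_curvature_function_def by blast
    then show ?thesis using c[of q] q UM by auto
  qed
  moreover have "tangent_part sol_metric ?r u (bitension sol_metric ?r u) = 0" if "u \<in> \<psi> ` U" for u
    using assms(6) U(1) that unfolding biconservative_def by blast
  ultimately have "c = 0"
    by (rule constant_mean_curvature_biconservative) (use U(2) in blast)+
  then show "f p = 0"
    using c[OF p] by simp
qed

end
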